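(* Let $G$ be a Ramanujan graph on $n$ vertices of degree $d$, with $9\leq d$ and $d\neq n-1$. Then its orientable genus $\gamma$ satisfies \[ \gamma\geq \left\lceil \frac{(2d-4\sqrt{d-1}-5)^2-1}{48}\right\rceil. \]
   Context: A Ramanujan graph of degree $d$ is a connected $d$-regular simple graph such that every eigenvalue $\lambda$ of its adjacency matrix with $|\lambda|\neq d$ satisfies $|\lambda|\leq 2\sqrt{d-1}$. The orientable genus of a graph is the least $h$ such that it embeds in the sphere with $h$ handles. $a(G)$ denotes the second smallest Laplacian eigenvalue. *)

theory Defs
  imports
    "Jordan_Normal_Form.Char_Poly"
    "Graph_Theory.Digraph_Component"
    "HOL-Analysis.Analysis"
begin

text \<open>
  A finite simple graph is a \<^locale>\<open>graph\<close>, that is, a finite symmetric digraph without loops and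
  parallel arcs: an undirected edge is a pair of opposite arcs, and the degree of a vertex is its
  out-degree.
\<close>

definition undirected_edges :: "('a, 'b) pre_digraph \<Rightarrow> 'a set set" where
  "undirected_edges G = {{u, v} | u v. u \<rightarrow>\<^bsub>G\<^esub> v}"

definition adjacency_matrix :: "('a, 'b) pre_digraph \<Rightarrow> 'a list \<Rightarrow> real mat" where
  "adjacency_matrix G vs =
     Matrix.mat (length vs) (length vs) (\<lambda>(i, j). if vs ! i \<rightarrow>\<^bsub>G\<^esub> vs ! j then 1 else 0)"

text \<open>
  The list \<open>vs\<close> enumerates the vertices; the eigenvalues of the adjacency matrix do not depend on
  the enumeration. As the matrix is real symmetric, its eigenvalues are real.
\<close>

definition ramanujan_graph :: "('a, 'b) pre_digraph \<Rightarrow> nat \<Rightarrow> bool" where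
  "ramanujan_graph G d \<longleftrightarrow>
     graph G \<and> Digraph_Component.connected G \<and> (\<forall>v\<in>verts G. out_degree G v = d) \<and>
     (\<forall>vs l. distinct vs \<and> set vs = verts G \<and> eigenvalue (adjacency_matrix G vs) l \<and>
        \<bar>l\<bar> \<noteq> real d \<longrightarrow> \<bar>l\<bar> \<le> 2 * sqrt (real d - 1))"

text \<open>
  The sphere with \<open>h\<close> handles as a subset of Euclidean 3-space, written as \<^typ>\<open>complex \<times> real\<close>.
  The open discs of radius \<open>1 / (2 * h)\<close> around the \<open>h\<close> points \<open>handle_centre h i\<close> of the
  equatorial plane have disjoint closures inside the open unit disc. The vertical cylinder over the
  \<open>i\<close>-th disc cuts two open discs, a northern and a southern one, out of the unit sphere. These are
  removed, and their boundary circles are joined by a tube, the part of the wall of the cylinder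
  inside the unit ball. The \<open>h\<close> tubes are disjoint, and each of them is a handle: the result is the
  boundary of a ball with \<open>h\<close> tunnels drilled through it. For \<open>h = 0\<close> it is the unit sphere.
\<close>

definition handle_centre :: "nat \<Rightarrow> nat \<Rightarrow> complex" where
  "handle_centre h i = complex_of_real ((2 * real i + 1) / real h - 1)"

definition handle_radius :: "nat \<Rightarrow> real" where
  "handle_radius h = 1 / (2 * real h)"

definition sphere_with_handles :: "nat \<Rightarrow> (complex \<times> real) set" where
  "sphere_with_handles h =
     {(w, z). (w, z) \<in> sphere 0 1 \<and> (\<forall>i<h. w \<notin> ball (handle_centre h i) (handle_radius h))} \<union>
     {(w, z). (w, z) \<in> cball 0 1 \<and> (\<exists>i<h. w \<in> sphere (handle_centre h i) (handle_radius h))}"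

text \<open>
  Vertices are mapped to distinct points and edges to simple arcs joining the images of their ends;
  an arc passes through no other vertex, and two arcs meet only in the images of common ends.
\<close>

definition embeds_in :: "('a, 'b) pre_digraph \<Rightarrow> 'c::topological_space set \<Rightarrow> bool" where
  "embeds_in G S \<longleftrightarrow>
     (\<exists>(p :: 'a \<Rightarrow> 'c) (g :: 'a set \<Rightarrow> real \<Rightarrow> 'c).
        inj_on p (verts G) \<and> p ` verts G \<subseteq> S \<and>
        (\<forall>e\<in>undirected_edges G.
           Path_Connected.arc (g e) \<and> path_image (g e) \<subseteq> S \<and>
           {pathstart (g e), pathfinish (g e)} = p ` e \<and>
           path_image (g e) \<inter> p ` verts G = p ` e) \<and>
        (\<forall>e\<in>undirected_edges G. \<forall>f\<in>undirected_edges G. e \<noteq> f \<longrightarrow>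
           path_image (g e) \<inter> path_image (g f) = p ` (e \<inter> f)))"

definition is_orientable_genus :: "('a, 'b) pre_digraph \<Rightarrow> nat \<Rightarrow> bool" where
  "is_orientable_genus G k \<longleftrightarrow>
     embeds_in G (sphere_with_handles k) \<and>
     (\<forall>h. embeds_in G (sphere_with_handles h) \<longrightarrow> k \<le> h)"

end

theory Submission
  imports Defs
begin

text \<open>
  A \<open>d\<close>-regular simple graph has at least \<open>d + 1\<close> vertices, so Euler's inequality
  \<open>card E + 6 \<le> 3 * card V + 6 * h\<close> for graphs on the sphere with \<open>h\<close> handles bounds the genus from
  below by \<open>(d - 2) * (d - 3) / 12\<close>. This dominates the claimed bound, which is the same expression
  with the spectral quantity \<open>d - 2 * sqrt (d - 1)\<close>, at least \<open>3\<close>, in place of \<open>d\<close>.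

  Euler's inequality is reduced to combinatorics. Cut every edge of the embedded graph into thirds.
  The stars formed by the outer thirds and the middle thirds are compact connected sets, so a
  sufficiently fine quadrangulation of the surface separates those that are disjoint; hence the graph
  is a minor of the 1-skeleton of the quadrangulation. A minor is given by a spanning subgraph \<open>K\<close>: a
  forest that spans the branch sets together with one edge for every edge of the graph. The faces of
  the quadrangulation fall into classes that are connected across edges outside \<open>K\<close>. Each deleted edge
  merges at most two classes, and by parity of cuts the boundary of a class contains at least three
  sides of edges of the graph.
\<close>

section \<open>Minors of surface complexes\<close>

text \<open>The edges of the embedding are arbitrary arcs, so the complement of the drawing offers
  no manageable faces, and the surface is a mere point set without a cell structure. Passing to a
  minor of an explicit quadrangulation leaves finite sets to count; topology enters only through
  compactness and connectedness. The count: let the quadrangulation have V vertices, E edges and F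
  faces, and the graph U vertices and H edges. The forest has at least V - U edges, so at most E - H
  - (V - U) edges are deleted, and at least F minus that number of classes remain. They share 2H
  sides, at least three each, hence H + 3(V + F) <= 3(U + E). All faces are squares, so E = 2F, and
  V + 2h >= F + 2 yields H + 6 <= 3U + 6h. Working with an inequality in place of Euler's formula
  also covers embeddings that are not cellular.\<close>

definition linked :: "('e \<Rightarrow> 'v) \<Rightarrow> ('e \<Rightarrow> 'v) \<Rightarrow> 'e set \<Rightarrow> ('v \<times> 'v) set" where
  "linked a b X = (\<Union>e\<in>X. {(a e, b e), (b e, a e)})\<^sup>*"

lemma linked_refl [simp, intro]: "(x, x) \<in> linked a b X"
  by (simp add: linked_def)

lemma linked_trans: "(x, y) \<in> linked a b X \<Longrightarrow> (y, z) \<in> linked a b X \<Longrightarrow> (x, z) \<in> linked a b X"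
  unfolding linked_def by (rule rtrancl_trans)

lemma linked_sym: "(x, y) \<in> linked a b X \<Longrightarrow> (y, x) \<in> linked a b X"
proof -
  have "sym (\<Union>e\<in>X. {(a e, b e), (b e, a e)})" by (auto simp: sym_def)
  then show "(x, y) \<in> linked a b X \<Longrightarrow> (y, x) \<in> linked a b X"
    unfolding linked_def by (meson sym_rtrancl symD)
qed

lemma linked_edge: "e \<in> X \<Longrightarrow> (a e, b e) \<in> linked a b X"
  unfolding linked_def by blast

lemma linked_mono: "X \<subseteq> X' \<Longrightarrow> linked a b X \<subseteq> linked a b X'"
  unfolding linked_def by (rule rtrancl_mono) blast

lemma linked_closed:
  assumes "(x, y) \<in> linked a b X" "x \<in> B" "\<And>e. e \<in> X \<Longrightarrow> a e \<in> B \<longleftrightarrow> b e \<in> B"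
  shows "y \<in> B"
  using assms(1) unfolding linked_def
proof (induction rule: rtrancl_induct)
  case base
  then show ?case using assms(2) .
next
  case (step y z)
  then show ?case using assms(3) by blast
qed

text \<open>A walk that passes \<open>e\<close> several times can be shortened until it passes
  \<open>e\<close> at most once, in one of the two directions.\<close>

lemma linked_insertD:
  assumes "(x, y) \<in> linked a b (insert e X)"
  shows "(x, y) \<in> linked a b X
    \<or> (x, a e) \<in> linked a b X \<and> (b e, y) \<in> linked a b X
    \<or> (x, b e) \<in> linked a b X \<and> (a e, y) \<in> linked a b X"
  using assms unfolding linked_def[of a b "insert e X"]
proof (induction rule: rtrancl_induct)
  case base
  then show ?case by simp
next
  case (step y z)
  from step.hyps(2) consider "(y, z) \<in> linked a b X" | "y = a e" "z = b e" | "y = b e" "z = a e"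
    by (auto intro: linked_edge linked_sym[OF linked_edge])
  then show ?case
    using step.IH by cases (metis linked_refl linked_trans)+
qed

lemma linked_insert_absorb:
  assumes "(a e, b e) \<in> linked a b X"
  shows "linked a b (insert e X) = linked a b X"
proof
  show "linked a b (insert e X) \<subseteq> linked a b X"
    using linked_insertD[of _ _ a b e X] assms linked_trans linked_sym by (metis subrelI)
qed (rule linked_mono, blast)

text \<open>A lower bound for the number of classes: an edge merges at most two of them, so each
  step drops at most one representative, the one linked to \<open>a e\<close>. The bound serves both
  for a graph and, with the two faces beside an edge as its ends, for its dual.\<close>

lemma unlinked_representatives:
  fixes a b :: "'e \<Rightarrow> 'v"
  assumes "finite X" "finite V"
  shows "\<exists>r\<subseteq>V. card V \<le> card r + card X \<and> pairwise (\<lambda>x y. (x, y) \<notin> linked a b X) r"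
  using assms(1)
proof (induction X rule: finite_induct)
  case empty
  have "pairwise (\<lambda>x y. (x, y) \<notin> linked a b {}) V"
    by (auto simp: pairwise_def linked_def)
  then show ?case by auto
next
  case (insert e X)
  then obtain r where r: "r \<subseteq> V" "card V \<le> card r + card X"
    "pairwise (\<lambda>x y. (x, y) \<notin> linked a b X) r" by auto
  let ?R = "{x \<in> r. (x, a e) \<in> linked a b X}"
  have fin: "finite r" using r(1) assms(2) finite_subset by blast
  have "\<exists>x. ?R \<subseteq> {x}"
    using r(3) unfolding pairwise_def by (smt (verit) linked_sym linked_trans mem_Collect_eq singletonI subsetI)
  then obtain x where x: "?R \<subseteq> {x}" by blast
  have "pairwise (\<lambda>x y. (x, y) \<notin> linked a b (insert e X)) (r - {x})"
  proof (rule pairwiseI)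
    fix u v assume uv: "u \<in> r - {x}" "v \<in> r - {x}" "u \<noteq> v"
    have "(u, a e) \<notin> linked a b X" "(v, a e) \<notin> linked a b X" using uv x by auto
    moreover have "(u, v) \<notin> linked a b X" using uv r(3) by (auto simp: pairwise_def)
    ultimately show "(u, v) \<notin> linked a b (insert e X)"
      using linked_insertD[of u v a b e X] linked_sym by metis
  qed
  moreover have "card V \<le> card (r - {x}) + card (insert e X)"
    using r(2) insert.hyps fin by (auto simp: card_Diff_singleton_if)
  ultimately show ?case using r(1) by blast
qed

lemma pairwise_disjoint_card_sum_le:
  assumes "finite R" "finite S" "\<And>f. f \<in> R \<Longrightarrow> P f \<subseteq> S"
    and "\<And>f g. f \<in> R \<Longrightarrow> g \<in> R \<Longrightarrow> f \<noteq> g \<Longrightarrow> P f \<inter> P g = {}"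
  shows "(\<Sum>f\<in>R. card (P f)) \<le> card S"
proof -
  have "(\<Sum>f\<in>R. card (P f)) = card (\<Union>f\<in>R. P f)"
    using assms by (intro card_UN_disjoint[symmetric]) (auto intro: finite_subset)
  also have "\<dots> \<le> card S"
    using assms by (intro card_mono) auto
  finally show ?thesis .
qed

text \<open>\<open>parity\<close> expresses, through intersections with vertex cuts, that the
  boundary modulo 2 of a set of faces is a cycle. A class of faces with at most two sides on edges
  of the minor turns out to have empty boundary; by \<open>dual\<close> it is all of
  \<open>F\<close>, and then it has \<open>2 * card H\<close>, hence at least four, sides.\<close>

lemma minor_edge_bound:
  fixes a b :: "'e \<Rightarrow> 'v" and f\<^sub>1 f\<^sub>2 :: "'e \<Rightarrow> 'f" and \<beta> :: "'v \<Rightarrow> 'w"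
  assumes fin: "finite V" "finite E" "finite F" "finite U" "finite H"
    and faces: "\<And>e. e \<in> E \<Longrightarrow> f\<^sub>1 e \<in> F \<and> f\<^sub>2 e \<in> F"
    and parity: "\<And>B C. C \<subseteq> F \<Longrightarrow>
      even (card {e \<in> E. (a e \<in> B) \<noteq> (b e \<in> B) \<and> (f\<^sub>1 e \<in> C) \<noteq> (f\<^sub>2 e \<in> C)})"
    and dual: "\<And>C. C \<subseteq> F \<Longrightarrow> C \<noteq> {} \<Longrightarrow> (\<And>e. e \<in> E \<Longrightarrow> f\<^sub>1 e \<in> C \<longleftrightarrow> f\<^sub>2 e \<in> C) \<Longrightarrow> C = F"
    and label: "\<beta> ` V \<subseteq> U"
    and conn: "\<And>x y. x \<in> V \<Longrightarrow> y \<in> V \<Longrightarrow> \<beta> x = \<beta> y \<Longrightarrow>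
      (x, y) \<in> linked a b {e \<in> E. \<beta> (a e) = \<beta> (b e)}"
    and edges: "\<And>k. k \<in> H \<Longrightarrow> \<exists>e\<in>E. \<beta> (a e) \<noteq> \<beta> (b e) \<and> {\<beta> (a e), \<beta> (b e)} = k"
    and two: "2 \<le> card H"
  shows "card H + 3 * (card V + card F) \<le> 3 * (card U + card E)"
proof -
  obtain \<epsilon> where \<epsilon>: "\<And>k. k \<in> H \<Longrightarrow> \<epsilon> k \<in> E \<and> \<beta> (a (\<epsilon> k)) \<noteq> \<beta> (b (\<epsilon> k)) \<and> {\<beta> (a (\<epsilon> k)), \<beta> (b (\<epsilon> k))} = k"
    using edges by metis
  define S where "S = \<epsilon> ` H"
  have inj: "inj_on \<epsilon> H" using \<epsilon> by (metis inj_onI)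
  have cS: "card S = card H" unfolding S_def using inj by (rule card_image)
  have S: "S \<subseteq> E" "finite S" using \<epsilon> fin unfolding S_def by auto
  have Sne: "\<beta> (a e) \<noteq> \<beta> (b e)" if "e \<in> S" for e using that \<epsilon> unfolding S_def by blast
  \<comment> \<open>Distinct edges of \<open>S\<close> carry distinct label pairs; this is what
    excludes classes bounded by a digon.\<close>
  have Sinj: "e = e'" if "e \<in> S" "e' \<in> S" "{\<beta> (a e), \<beta> (b e)} = {\<beta> (a e'), \<beta> (b e')}" for e e'
    using that \<epsilon> unfolding S_def by (metis imageE)
  define I where "I = {e \<in> E. \<beta> (a e) = \<beta> (b e)}"
  \<comment> \<open>A smallest \<open>T\<close> with the connectivity of \<open>I\<close> is a
    spanning forest of the branch sets: by minimality each of its edges is a bridge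
    (\<open>Tcut\<close>).\<close>
  let ?P = "\<lambda>T. T \<subseteq> I \<and> linked a b T = linked a b I"
  have "?P I" by simp
  then obtain T where T: "?P T" and Tmin: "\<And>T'. ?P T' \<Longrightarrow> card T \<le> card T'"
    using ex_has_least_nat[of ?P I card] by blast
  have finI: "finite I" using fin by (auto simp: I_def)
  then have finT: "finite T" using T finite_subset by blast
  have Tcut: "(a e, b e) \<notin> linked a b (T - {e})" if "e \<in> T" for e
  proof
    assume "(a e, b e) \<in> linked a b (T - {e})"
    then have "linked a b (T - {e}) = linked a b T"
      using linked_insert_absorb[of a e b "T - {e}"] that by (simp add: insert_absorb)
    then have "?P (T - {e})" using T by auto
    then have "card T \<le> card (T - {e})" by (rule Tmin)
    then show False using that finT by (metis card_Diff1_less leD)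
  qed
  have VT: "card V \<le> card U + card T"
  proof -
    obtain r where r: "r \<subseteq> V" "card V \<le> card r + card T" "pairwise (\<lambda>x y. (x, y) \<notin> linked a b T) r"
      using unlinked_representatives[OF finT fin(1), of a b] by blast
    have "inj_on \<beta> r"
    proof (rule inj_onI, rule ccontr)
      fix x y assume "x \<in> r" "y \<in> r" "\<beta> x = \<beta> y" "x \<noteq> y"
      then show False using r conn[of x y] T unfolding pairwise_def I_def by blast
    qed
    then have "card r \<le> card U" using r(1) label fin(4) by (meson card_inj_on_le image_mono order_trans)
    then show ?thesis using r(2) by simp
  qed
  have TS: "T \<inter> S = {}" "T \<subseteq> E" using T Sne unfolding I_def by auto
  define X where "X = E - (S \<union> T)"
  have cX: "card X + card S + card T = card E"
  proof -
    have "card (S \<union> T) = card S + card T" using TS S finT by (intro card_Un_disjoint) auto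
    moreover have "card (S \<union> T) \<le> card E" using S TS fin by (intro card_mono) auto
    ultimately show ?thesis unfolding X_def using S TS finT fin by (subst card_Diff_subset) auto
  qed
  obtain r where r: "r \<subseteq> F" "card F \<le> card r + card X" "pairwise (\<lambda>x y. (x, y) \<notin> linked f\<^sub>1 f\<^sub>2 X) r"
    using unlinked_representatives[of X F f\<^sub>1 f\<^sub>2] fin unfolding X_def by blast
  define C where "C f = {g \<in> F. (f, g) \<in> linked f\<^sub>1 f\<^sub>2 X}" for f
  have Cdisj: "C f \<inter> C g = {}" if "f \<in> r" "g \<in> r" "f \<noteq> g" for f g
    using that r(3) unfolding C_def pairwise_def by (auto dest: linked_sym linked_trans)
  \<comment> \<open>A side is an edge together with one of its two faces, so an edge with the class
    on both sides counts twice. All classes together have \<open>2 * card S\<close> sides.\<close>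
  have sides: "3 \<le> card {e \<in> S. f\<^sub>1 e \<in> C f} + card {e \<in> S. f\<^sub>2 e \<in> C f}" if "f \<in> r" for f
  proof (rule ccontr)
    assume "\<not> ?thesis"
    then have le2: "card {e \<in> S. f\<^sub>1 e \<in> C f} + card {e \<in> S. f\<^sub>2 e \<in> C f} \<le> 2" by simp
    \<comment> \<open>The boundary modulo 2 of the class. It avoids \<open>X\<close>, because
      crossing an edge of \<open>X\<close> does not leave the class.\<close>
    define D where "D = {e \<in> E. (f\<^sub>1 e \<in> C f) \<noteq> (f\<^sub>2 e \<in> C f)}"
    have CF: "C f \<subseteq> F" "f \<in> C f" using r(1) that unfolding C_def by auto
    have DK: "D \<subseteq> S \<union> T"
    proof
      fix e assume e: "e \<in> D"
      show "e \<in> S \<union> T"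
      proof (rule ccontr)
        assume "e \<notin> S \<union> T"
        then have "e \<in> X" using e unfolding D_def X_def by auto
        then have "(f\<^sub>1 e, f\<^sub>2 e) \<in> linked f\<^sub>1 f\<^sub>2 X" by (rule linked_edge)
        moreover have "f\<^sub>1 e \<in> F" "f\<^sub>2 e \<in> F" using e faces unfolding D_def by auto
        ultimately show False using e unfolding D_def C_def
          by (auto dest: linked_trans linked_sym)
      qed
    qed
    have even: "even (card {e \<in> D. (a e \<in> B) \<noteq> (b e \<in> B)})" for B
      using parity[OF CF(1), of B] unfolding D_def by (simp add: conj_commute conj_left_commute)
    have finD: "finite (D \<inter> S)" using S by auto
    \<comment> \<open>The cut around all vertices with label \<open>u\<close> does not see
      \<open>T\<close>, whose edges have equally labelled ends.\<close>
    have Dcut: "{e \<in> D. (a e \<in> B) \<noteq> (b e \<in> B)} = {e \<in> D \<inter> S. (\<beta> (a e) = u) \<noteq> (\<beta> (b e) = u)}"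
      if "B = {x. \<beta> x = u}" for B u
      using DK T that unfolding I_def by auto
    \<comment> \<open>One edge, or two edges with different label pairs, always admit a label
      \<open>u\<close> at exactly one of them; the cut around \<open>u\<close> would then have size
      one, which is odd.\<close>
    have DS: "D \<inter> S = {}"
    proof -
      have "card (D \<inter> S) \<le> card ({e \<in> S. f\<^sub>1 e \<in> C f} \<union> {e \<in> S. f\<^sub>2 e \<in> C f})"
        using S by (intro card_mono) (auto simp: D_def)
      also have "\<dots> \<le> 2" using le2 card_Un_le le_trans by blast
      finally have "card (D \<inter> S) \<le> 2" .
      then consider "D \<inter> S = {}" | e where "D \<inter> S = {e}" | e e' where "e \<noteq> e'" "D \<inter> S = {e, e'}"
        using finD by (metis card_0_eq card_1_singletonE card_2_iff le_0_eq le_Suc_eq numeral_2_eq_2 One_nat_def)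
      then show ?thesis
      proof cases
        case 1
        then show ?thesis .
      next
        case (2 e)
        then have "e \<in> S" by blast
        with 2 have "{g \<in> D \<inter> S. (\<beta> (a g) = \<beta> (a e)) \<noteq> (\<beta> (b g) = \<beta> (a e))} = {e}"
          using Sne[of e] by auto
        then show ?thesis using even[of "{x. \<beta> x = \<beta> (a e)}"] Dcut[OF refl, of "\<beta> (a e)"] by simp
      next
        case (3 e e')
        have ee: "e \<in> S" "e' \<in> S" using 3 by auto
        have "\<exists>u. ((\<beta> (a e) = u) \<noteq> (\<beta> (b e) = u)) \<and> ((\<beta> (a e') = u) = (\<beta> (b e') = u))"
        proof (rule ccontr)
          assume "\<not> ?thesis"
          then have *: "((\<beta> (a e') = u) \<noteq> (\<beta> (b e') = u))" if "(\<beta> (a e) = u) \<noteq> (\<beta> (b e) = u)" for u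
            using that by blast
          have "{\<beta> (a e), \<beta> (b e)} = {\<beta> (a e'), \<beta> (b e')}"
            using *[of "\<beta> (a e)"] *[of "\<beta> (b e)"] Sne[OF ee(1)] Sne[OF ee(2)] by auto
          then show False using Sinj ee 3(1) by blast
        qed
        then obtain u where "((\<beta> (a e) = u) \<noteq> (\<beta> (b e) = u))" "((\<beta> (a e') = u) = (\<beta> (b e') = u))"
          by blast
        then have "{g \<in> D \<inter> S. (\<beta> (a g) = u) \<noteq> (\<beta> (b g) = u)} = {e}"
          using 3 by auto
        then show ?thesis using even[of "{x. \<beta> x = u}"] Dcut[OF refl, of u] by simp
      qed
    qed
    have "D = {}"
    proof (rule ccontr)
      assume "D \<noteq> {}"
      then obtain e where e: "e \<in> D" by blast
      then have eT: "e \<in> T" using DK DS by auto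
      \<comment> \<open>Now the boundary lies in the forest. Removing \<open>e\<close> splits its
        tree, and the cut around the part at \<open>a e\<close> meets the boundary in
        \<open>e\<close> alone.\<close>
      define B where "B = {x. (a e, x) \<in> linked a b (T - {e})}"
      have "(a g \<in> B) = (b g \<in> B)" if "g \<in> T" "g \<noteq> e" for g
        using linked_edge[of g "T - {e}" a b] that unfolding B_def
        by (auto dest: linked_trans linked_sym)
      moreover have "a e \<in> B" "b e \<notin> B" using Tcut[OF eT] unfolding B_def by auto
      ultimately have "{g \<in> D. (a g \<in> B) \<noteq> (b g \<in> B)} = {e}" using DK DS e by auto
      then show False using even[of B] by simp
    qed
    then have "f\<^sub>1 e \<in> C f \<longleftrightarrow> f\<^sub>2 e \<in> C f" if "e \<in> E" for e
      using that unfolding D_def by blast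
    then have "C f = F" using dual[of "C f"] CF by blast
    then have "{e \<in> S. f\<^sub>1 e \<in> C f} = S" "{e \<in> S. f\<^sub>2 e \<in> C f} = S" using S faces by auto
    then show False using le2 two cS by simp
  qed
  have finr: "finite r" using r(1) fin finite_subset by blast
  have "3 * card r = (\<Sum>f\<in>r. 3)" by simp
  also have "\<dots> \<le> (\<Sum>f\<in>r. card {e \<in> S. f\<^sub>1 e \<in> C f} + card {e \<in> S. f\<^sub>2 e \<in> C f})"
    using sides by (intro sum_mono) auto
  also have "\<dots> \<le> card S + card S"
    unfolding sum.distrib using Cdisj finr S
    by (intro add_mono pairwise_disjoint_card_sum_le) blast+
  finally have "3 * card r \<le> 2 * card S" by simp
  then show ?thesis using r(2) cX VT cS unfolding distrib_left by linarith
qed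


text \<open>Connectedness supplies an edge leaving \<open>W\<close>; its outer end takes the label
  of its inner end. Labels on \<open>W\<close> stay fixed, so edges already found between
  differently labelled vertices survive while the branch sets grow to cover all vertices, as the
  count in \<open>minor_edge_bound\<close> requires.\<close>

lemma extend_labelling:
  fixes a b :: "'e \<Rightarrow> 'v" and \<beta> :: "'v \<Rightarrow> 'w"
  assumes "finite V" "W \<subseteq> V" "W \<noteq> {}"
    and ends: "\<And>e. e \<in> E \<Longrightarrow> a e \<in> V \<and> b e \<in> V"
    and conn: "\<And>x y. x \<in> V \<Longrightarrow> y \<in> V \<Longrightarrow> (x, y) \<in> linked a b E"
    and "\<beta> ` W \<subseteq> U"
    and "\<And>x y. x \<in> W \<Longrightarrow> y \<in> W \<Longrightarrow> \<beta> x = \<beta> y \<Longrightarrow>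
      (x, y) \<in> linked a b {e \<in> E. a e \<in> W \<and> b e \<in> W \<and> \<beta> (a e) = \<beta> (b e)}"
  shows "\<exists>\<beta>'. (\<forall>x\<in>W. \<beta>' x = \<beta> x) \<and> \<beta>' ` V \<subseteq> U \<and>
    (\<forall>x\<in>V. \<forall>y\<in>V. \<beta>' x = \<beta>' y \<longrightarrow> (x, y) \<in> linked a b {e \<in> E. \<beta>' (a e) = \<beta>' (b e)})"
  using assms(2,3,6,7)
proof (induction "card (V - W)" arbitrary: W \<beta>)
  case 0
  then have "W = V" using assms(1) by auto
  moreover have "{e \<in> E. a e \<in> V \<and> b e \<in> V \<and> \<beta> (a e) = \<beta> (b e)} = {e \<in> E. \<beta> (a e) = \<beta> (b e)}"
    using ends by blast
  ultimately show ?case using 0 by (intro exI[of _ \<beta>]) auto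
next
  case (Suc n)
  have "V - W \<noteq> {}" using Suc.hyps(2) by force
  then obtain x y where xy: "x \<in> W" "y \<in> V - W" using Suc.prems by blast
  have "\<exists>e\<in>E. (a e \<in> W) \<noteq> (b e \<in> W)"
  proof (rule ccontr)
    assume "\<not> ?thesis"
    then have "y \<in> W" using linked_closed[OF conn[of x y] xy(1)] xy Suc.prems(1) by blast
    then show False using xy by blast
  qed
  then obtain e v u where e: "e \<in> E" "v \<in> W" "u \<in> V - W" "(a e = v \<and> b e = u) \<or> (a e = u \<and> b e = v)"
    using ends by blast
  define \<gamma> where "\<gamma> = \<beta>(u := \<beta> v)"
  let ?W = "insert u W"
  let ?L = "linked a b {e \<in> E. a e \<in> ?W \<and> b e \<in> ?W \<and> \<gamma> (a e) = \<gamma> (b e)}"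
  have \<gamma>W: "\<gamma> x = \<beta> x" if "x \<in> W" for x using that e unfolding \<gamma>_def by auto
  have "{e \<in> E. a e \<in> W \<and> b e \<in> W \<and> \<beta> (a e) = \<beta> (b e)}
    \<subseteq> {e \<in> E. a e \<in> ?W \<and> b e \<in> ?W \<and> \<gamma> (a e) = \<gamma> (b e)}"
    using \<gamma>W by auto
  then have old: "(x, y) \<in> ?L" if "x \<in> W" "y \<in> W" "\<beta> x = \<beta> y" for x y
    using Suc.prems(4)[OF that] linked_mono by blast
  have "\<gamma> u = \<gamma> v" using e(2,3) unfolding \<gamma>_def by auto
  then have "(a e, b e) \<in> ?L" using e by (intro linked_edge) auto
  then have uv: "(u, v) \<in> ?L" "(v, u) \<in> ?L" using e(4) linked_sym[of "a e" "b e"] by auto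
  have "n = card (V - ?W)" using Suc.hyps(2) e(3) assms(1)
    by (metis Diff_insert card_Diff_singleton diff_Suc_1)
  moreover have "(x, y) \<in> ?L" if "x \<in> ?W" "y \<in> ?W" "\<gamma> x = \<gamma> y" for x y
  proof -
    define x' where "x' = (if x = u then v else x)"
    define y' where "y' = (if y = u then v else y)"
    have "x' \<in> W" "y' \<in> W" "\<beta> x' = \<beta> y'"
      using that e unfolding x'_def y'_def \<gamma>_def by (auto split: if_splits)
    then have "(x', y') \<in> ?L" by (rule old)
    moreover have "(x, x') \<in> ?L" "(y', y) \<in> ?L" using uv unfolding x'_def y'_def by auto
    ultimately show ?thesis using linked_trans[of x x'] linked_trans[of x y'] by blast
  qed
  moreover have "?W \<subseteq> V" "?W \<noteq> {}" "\<gamma> ` ?W \<subseteq> U"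
    using Suc.prems(1,3) e(2,3) unfolding \<gamma>_def by (auto split: if_splits)
  ultimately obtain \<beta>' where "\<forall>x\<in>?W. \<beta>' x = \<gamma> x" "\<beta>' ` V \<subseteq> U"
    "\<forall>x\<in>V. \<forall>y\<in>V. \<beta>' x = \<beta>' y \<longrightarrow> (x, y) \<in> linked a b {e \<in> E. \<beta>' (a e) = \<beta>' (b e)}"
    using Suc.hyps(1)[of ?W \<gamma>] by blast
  then show ?case using \<gamma>W by (intro exI[of _ \<beta>']) auto
qed

section \<open>Branch sets from discretised stars and middle thirds\<close>

definition linked_within :: "('e \<Rightarrow> 'v) \<Rightarrow> ('e \<Rightarrow> 'v) \<Rightarrow> 'e set \<Rightarrow> 'v set \<Rightarrow> bool" where
  "linked_within a b E A \<longleftrightarrow> (\<forall>x\<in>A. \<forall>y\<in>A. (x, y) \<in> linked a b {e \<in> E. a e \<in> A \<and> b e \<in> A})"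

lemma linked_withinI_root:
  assumes "\<And>x. x \<in> A \<Longrightarrow> (r, x) \<in> linked a b {e \<in> E. a e \<in> A \<and> b e \<in> A}"
  shows "linked_within a b E A"
  unfolding linked_within_def using linked_trans[OF linked_sym[OF assms] assms] by blast

lemma linked_within_subset:
  assumes "linked_within a b E A" "A \<subseteq> A'" "x \<in> A" "y \<in> A"
  shows "(x, y) \<in> linked a b {e \<in> E. a e \<in> A' \<and> b e \<in> A'}"
proof -
  have "{e \<in> E. a e \<in> A \<and> b e \<in> A} \<subseteq> {e \<in> E. a e \<in> A' \<and> b e \<in> A'}" using assms(2) by auto
  then show ?thesis using assms linked_mono unfolding linked_within_def by blast
qed

text \<open>\<open>D u\<close> stands for the star of the vertex \<open>u\<close> and
  \<open>M k\<close> for the middle third of the edge \<open>k\<close>. The latter overlaps the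
  stars of both ends of \<open>k\<close>, so it is given to one end only: the branch set of the tail
  takes what can be reached in \<open>M k\<close> before the star of the head is entered.\<close>

lemma subdivision_labelling:
  fixes a b :: "'e \<Rightarrow> 'v" and D :: "'w \<Rightarrow> 'v set" and M :: "'w set \<Rightarrow> 'v set"
  assumes fin: "finite V"
    and ends: "\<And>e. e \<in> E \<Longrightarrow> a e \<in> V \<and> b e \<in> V"
    and conn: "\<And>x y. x \<in> V \<Longrightarrow> y \<in> V \<Longrightarrow> (x, y) \<in> linked a b E"
    and H: "\<And>k. k \<in> H \<Longrightarrow> \<exists>u v. u \<noteq> v \<and> k = {u, v} \<and> u \<in> U \<and> v \<in> U" and U: "U \<noteq> {}"
    and D: "\<And>u. u \<in> U \<Longrightarrow> D u \<noteq> {} \<and> D u \<subseteq> V \<and> linked_within a b E (D u)"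
    and M: "\<And>k. k \<in> H \<Longrightarrow> M k \<subseteq> V \<and> linked_within a b E (M k)"
    and DD: "\<And>u v. u \<in> U \<Longrightarrow> v \<in> U \<Longrightarrow> u \<noteq> v \<Longrightarrow> D u \<inter> D v = {}"
    and MM: "\<And>k l. k \<in> H \<Longrightarrow> l \<in> H \<Longrightarrow> k \<noteq> l \<Longrightarrow> M k \<inter> M l = {}"
    and DM: "\<And>u k. u \<in> U \<Longrightarrow> k \<in> H \<Longrightarrow> D u \<inter> M k \<noteq> {} \<longleftrightarrow> u \<in> k"
  shows "\<exists>\<beta>. \<beta> ` V \<subseteq> U \<and>
    (\<forall>x\<in>V. \<forall>y\<in>V. \<beta> x = \<beta> y \<longrightarrow> (x, y) \<in> linked a b {e \<in> E. \<beta> (a e) = \<beta> (b e)}) \<and>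
    (\<forall>k\<in>H. \<exists>e\<in>E. \<beta> (a e) \<noteq> \<beta> (b e) \<and> {\<beta> (a e), \<beta> (b e)} = k)"
proof -
  obtain t h where th: "\<And>k. k \<in> H \<Longrightarrow> t k \<noteq> h k \<and> k = {t k, h k} \<and> t k \<in> U \<and> h k \<in> U"
    using H by metis
  have "\<exists>x. x \<in> M k \<and> x \<in> D (t k)" if "k \<in> H" for k
    using DM[of "t k" k] th[OF that] that by auto
  then obtain x\<^sub>0 where x0: "\<And>k. k \<in> H \<Longrightarrow> x\<^sub>0 k \<in> M k \<and> x\<^sub>0 k \<in> D (t k)" by metis
  define N where "N k = M k - D (h k)" for k
  define P where "P k = {x \<in> N k. (x\<^sub>0 k, x) \<in> linked a b {e \<in> E. a e \<in> N k \<and> b e \<in> N k}}" for k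
  define B where "B u = D u \<union> (\<Union>k\<in>{k \<in> H. t k = u}. P k)" for u
  have x0P: "x\<^sub>0 k \<in> P k" if "k \<in> H" for k
    using x0[OF that] DD[of "t k" "h k"] th[OF that] unfolding P_def N_def by auto
  have PD: "P k \<inter> D v = {}" if "k \<in> H" "v \<in> U" "v \<noteq> t k" for k v
    using DM[of v k] th[of k] that unfolding P_def N_def by auto
  have PP: "P k \<inter> P l = {}" if "k \<in> H" "l \<in> H" "k \<noteq> l" for k l
    using MM[OF that] unfolding P_def N_def by auto
  have Bdisj: "B u \<inter> B v = {}" if "u \<in> U" "v \<in> U" "u \<noteq> v" for u v
    using DD[OF that] PD PP that unfolding B_def by blast
  have Plink: "(x\<^sub>0 k, x) \<in> linked a b {e \<in> E. a e \<in> P k \<and> b e \<in> P k}" if "k \<in> H" "x \<in> P k" for k x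
  proof -
    let ?Z = "{y \<in> P k. (x\<^sub>0 k, y) \<in> linked a b {e \<in> E. a e \<in> P k \<and> b e \<in> P k}}"
    have "x \<in> ?Z"
    proof (rule linked_closed)
      show "(x\<^sub>0 k, x) \<in> linked a b {e \<in> E. a e \<in> N k \<and> b e \<in> N k}" using that unfolding P_def by blast
      show "x\<^sub>0 k \<in> ?Z" using x0P that by simp
      fix e assume e: "e \<in> {e \<in> E. a e \<in> N k \<and> b e \<in> N k}"
      then have l: "(a e, b e) \<in> linked a b {e \<in> E. a e \<in> N k \<and> b e \<in> N k}" by (rule linked_edge)
      then have ab: "a e \<in> P k \<longleftrightarrow> b e \<in> P k"
        using e unfolding P_def by (auto dest: linked_trans linked_sym)
      then have "(a e, b e) \<in> linked a b {e \<in> E. a e \<in> P k \<and> b e \<in> P k}" if "a e \<in> P k"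
        using that e by (intro linked_edge) auto
      then show "a e \<in> ?Z \<longleftrightarrow> b e \<in> ?Z" using ab by (auto dest: linked_trans linked_sym)
    qed
    then show ?thesis by blast
  qed
  have Bconn: "linked_within a b E (B u)" if u: "u \<in> U" for u
  proof -
    obtain r where r: "r \<in> D u" using D[OF u] by blast
    show ?thesis
    proof (rule linked_withinI_root)
      fix x assume "x \<in> B u"
      then consider "x \<in> D u" | k where "k \<in> H" "t k = u" "x \<in> P k" unfolding B_def by auto
      then show "(r, x) \<in> linked a b {e \<in> E. a e \<in> B u \<and> b e \<in> B u}"
      proof cases
        case 1
        then show ?thesis using linked_within_subset[of a b E "D u" "B u" r x] D[OF u] r
          unfolding B_def by blast
      next
        case (2 k)
        have "(r, x\<^sub>0 k) \<in> linked a b {e \<in> E. a e \<in> B u \<and> b e \<in> B u}"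
          using linked_within_subset[of a b E "D u" "B u" r "x\<^sub>0 k"] D[OF u] r x0[OF 2(1)] 2(2)
          unfolding B_def by blast
        moreover have "{e \<in> E. a e \<in> P k \<and> b e \<in> P k} \<subseteq> {e \<in> E. a e \<in> B u \<and> b e \<in> B u}"
          using 2 unfolding B_def by auto
        then have "(x\<^sub>0 k, x) \<in> linked a b {e \<in> E. a e \<in> B u \<and> b e \<in> B u}"
          using Plink[OF 2(1,3)] linked_mono by blast
        ultimately show ?thesis by (rule linked_trans)
      qed
    qed
  qed
  have Bedge: "\<exists>e\<in>E. (a e \<in> B (t k) \<and> b e \<in> B (h k)) \<or> (a e \<in> B (h k) \<and> b e \<in> B (t k))" if k: "k \<in> H" for k
  proof -
    obtain y where y: "y \<in> M k" "y \<in> D (h k)" using DM[of "h k" k] th[OF k] k by blast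
    have l: "(x\<^sub>0 k, y) \<in> linked a b {e \<in> E. a e \<in> M k \<and> b e \<in> M k}"
      using M[OF k] x0[OF k] y unfolding linked_within_def by blast
    \<comment> \<open>Inside \<open>M k\<close>, a walk from the tail's star to \<open>y\<close>
      leaves \<open>P k\<close>. The edge where it does so ends in \<open>D (h k)\<close>: any other
      end would lie in \<open>N k\<close> and then in \<open>P k\<close> as well.\<close>
    have "y \<notin> P k" using y unfolding P_def N_def by blast
    then obtain e where e: "e \<in> E" "a e \<in> M k" "b e \<in> M k" "(a e \<in> P k) \<noteq> (b e \<in> P k)"
      using linked_closed[OF l x0P[OF k]] by blast
    have "\<not> (a e \<in> N k \<and> b e \<in> N k)"
    proof
      assume N: "a e \<in> N k \<and> b e \<in> N k"
      then have "(a e, b e) \<in> linked a b {e \<in> E. a e \<in> N k \<and> b e \<in> N k}"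
        using e by (intro linked_edge) auto
      then have "a e \<in> P k \<longleftrightarrow> b e \<in> P k"
        using N unfolding P_def by (auto dest: linked_trans linked_sym)
      then show False using e by blast
    qed
    then have "(a e \<in> P k \<and> b e \<in> D (h k)) \<or> (a e \<in> D (h k) \<and> b e \<in> P k)"
      using e unfolding N_def P_def by blast
    then show ?thesis using e(1) k unfolding B_def by blast
  qed
  define W where "W = (\<Union>u\<in>U. B u)"
  define \<beta> where "\<beta> x = (THE u. u \<in> U \<and> x \<in> B u)" for x
  have \<beta>: "\<beta> x = u" if "u \<in> U" "x \<in> B u" for x u
    unfolding \<beta>_def using that Bdisj by (intro the_equality) blast+
  have "W \<subseteq> V" using D M unfolding W_def B_def P_def N_def by blast
  moreover have "W \<noteq> {}" using U D unfolding W_def B_def by blast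
  moreover have "\<beta> ` W \<subseteq> U" using \<beta> unfolding W_def by auto
  moreover have "(x, y) \<in> linked a b {e \<in> E. a e \<in> W \<and> b e \<in> W \<and> \<beta> (a e) = \<beta> (b e)}"
    if xy: "x \<in> W" "y \<in> W" "\<beta> x = \<beta> y" for x y
  proof -
    obtain u where u: "u \<in> U" "x \<in> B u" "y \<in> B u" using xy \<beta> unfolding W_def by auto
    have "{e \<in> E. a e \<in> B u \<and> b e \<in> B u} \<subseteq> {e \<in> E. a e \<in> W \<and> b e \<in> W \<and> \<beta> (a e) = \<beta> (b e)}"
      using u(1) \<beta> unfolding W_def by auto
    then show ?thesis using Bconn[OF u(1)] u linked_mono unfolding linked_within_def by blast
  qed
  ultimately obtain \<beta>' where \<beta>': "\<forall>x\<in>W. \<beta>' x = \<beta> x" "\<beta>' ` V \<subseteq> U"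
    "\<forall>x\<in>V. \<forall>y\<in>V. \<beta>' x = \<beta>' y \<longrightarrow> (x, y) \<in> linked a b {e \<in> E. \<beta>' (a e) = \<beta>' (b e)}"
    using extend_labelling[of V W E a b \<beta> U] fin ends conn by blast
  have \<beta>'B: "\<beta>' x = u" if "u \<in> U" "x \<in> B u" for x u using \<beta>'(1) \<beta> that unfolding W_def by auto
  have "\<exists>e\<in>E. \<beta>' (a e) \<noteq> \<beta>' (b e) \<and> {\<beta>' (a e), \<beta>' (b e)} = k" if k: "k \<in> H" for k
  proof -
    obtain e where e: "e \<in> E" "(a e \<in> B (t k) \<and> b e \<in> B (h k)) \<or> (a e \<in> B (h k) \<and> b e \<in> B (t k))"
      using Bedge[OF k] by blast
    have "t k \<noteq> h k" "t k \<in> U" "h k \<in> U" and k': "{t k, h k} = k" using th[OF k] by auto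
    with e(2) have "\<beta>' (a e) \<noteq> \<beta>' (b e) \<and> {\<beta>' (a e), \<beta>' (b e)} = {t k, h k}"
      using \<beta>'B[of "t k"] \<beta>'B[of "h k"] by auto
    then show ?thesis using e(1) unfolding k' by blast
  qed
  then show ?thesis using \<beta>' by blast
qed

section \<open>Four copies of a strip with tabs\<close>

lemma involution_transversal:
  fixes \<iota> :: "'d \<Rightarrow> 'd"
  assumes "finite D" and "\<And>d. d \<in> D \<Longrightarrow> \<iota> d \<in> D \<and> \<iota> (\<iota> d) = d \<and> \<iota> d \<noteq> d"
  shows "\<exists>E. E \<inter> \<iota> ` E = {} \<and> E \<union> \<iota> ` E = D"
proof -
  obtain r :: "'d \<Rightarrow> nat" where r: "inj_on r D"
    using finite_imp_inj_to_nat_seg[OF assms(1)] by blast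
  define E where "E = {d \<in> D. r d < r (\<iota> d)}"
  have "d \<in> E \<union> \<iota> ` E" if "d \<in> D" for d
  proof (cases "r d < r (\<iota> d)")
    case False
    then have "r (\<iota> d) < r d" using assms(2)[OF that] r that by (metis inj_onD nat_neq_iff)
    then have "\<iota> d \<in> E" using assms(2)[OF that] unfolding E_def by auto
    then show ?thesis using assms(2)[OF that] by (metis UnI2 imageI)
  qed (use that in \<open>auto simp: E_def\<close>)
  moreover have "E \<inter> \<iota> ` E = {}" using assms(2) unfolding E_def by fastforce
  moreover have "E \<union> \<iota> ` E \<subseteq> D" using assms(2) unfolding E_def by auto
  ultimately show ?thesis by blast
qed

text \<open>An edge with both sides in \<open>C\<close> accounts for two darts and an edge with one
  side in \<open>C\<close> for one dart, so the darts and the boundary edges agree in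
  parity.\<close>

lemma even_card_boundary:
  assumes fin: "finite D" and \<iota>: "\<And>d. d \<in> D \<Longrightarrow> \<iota> (\<iota> d) = d"
    and E: "E \<inter> \<iota> ` E = {}" "E \<union> \<iota> ` E = D"
    and cross: "\<And>d. d \<in> D \<Longrightarrow> cross (\<iota> d) = cross d"
    and even: "even (card {d \<in> D. cross d \<and> \<phi> d \<in> C})"
  shows "even (card {e \<in> E. cross e \<and> (\<phi> e \<in> C) \<noteq> (\<phi> (\<iota> e) \<in> C)})"
proof -
  define P where "P = {e \<in> E. cross e \<and> \<phi> e \<in> C}"
  define Q where "Q = {e \<in> E. cross e \<and> \<phi> (\<iota> e) \<in> C}"
  have finE: "finite E" using fin E by auto
  then have finPQ: "finite P" "finite Q" by (auto simp: P_def Q_def)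
  have "{d \<in> D. cross d \<and> \<phi> d \<in> C} = P \<union> \<iota> ` Q"
    using E cross unfolding P_def Q_def by auto
  moreover have "inj_on \<iota> Q"
    using \<iota> E(2) unfolding Q_def by (intro inj_on_inverseI[of _ \<iota>]) blast
  moreover have "P \<inter> \<iota> ` Q = {}" using E(1) unfolding P_def Q_def by auto
  ultimately have "card {d \<in> D. cross d \<and> \<phi> d \<in> C} = card P + card Q"
    using finPQ by (simp add: card_Un_disjoint card_image)
  moreover have "card P = card (P - Q) + card (P \<inter> Q)"
    using finPQ card_Int_Diff[of P Q] by simp
  moreover have "card Q = card (Q - P) + card (P \<inter> Q)"
    using finPQ card_Int_Diff[of Q P] by (simp add: Int_commute)
  moreover have "{e \<in> E. cross e \<and> (\<phi> e \<in> C) \<noteq> (\<phi> (\<iota> e) \<in> C)} = (P - Q) \<union> (Q - P)"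
    unfolding P_def Q_def by auto
  moreover have "card ((P - Q) \<union> (Q - P)) = card (P - Q) + card (Q - P)"
    using finPQ by (intro card_Un_disjoint) auto
  ultimately show ?thesis using even by auto
qed

section \<open>The combinatorial surface: cells, vertices, darts and gluing\<close>

datatype side = Rt | Up | Lf | Dn

lemma UNIV_side: "(UNIV :: side set) = {Rt, Up, Lf, Dn}"
  using side.exhaust by auto

instance side :: finite
  by standard (simp add: UNIV_side)

type_synonym quad = "int \<times> int \<times> int \<times> int"

text \<open>
  The quadrangulation of the glued surface. The strip has unit cells \<open>(i, j)\<close> with \<open>0 \<le> i < M\<close> and
  \<open>0 \<le> j < N\<close>, and below the columns \<open>i\<close> with \<open>c i\<close> also those with \<open>- N \<le> j < 0\<close>. Four copies, indexed by
  two signs \<open>s\<close> and \<open>t\<close>, are glued along their boundary: along \<open>yside\<close> the copies that differ in \<open>s\<close>, along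
  \<open>zside\<close> those that differ in \<open>t\<close>. A vertex \<open>(i, j, s, t)\<close> is normalised by replacing a sign that is
  identified with its negative by \<open>0\<close>.
\<close>

locale strip =
  fixes M N :: int and c :: "int \<Rightarrow> bool"
  assumes M: "0 < M" and N: "0 < N" and c: "\<And>i. c i \<Longrightarrow> 0 < i \<and> i < M - 1"
begin

definition cell :: "int \<Rightarrow> int \<Rightarrow> bool" where
  "cell i j \<longleftrightarrow> 0 \<le> i \<and> i < M \<and> - N \<le> j \<and> j < N \<and> (j < 0 \<longrightarrow> c i)"

text \<open>The lower edge of the strip and the flanks of the tabs: a vertex at or below row 0 is
  off this boundary only if both adjacent columns carry a tab.\<close>

definition yside :: "int \<Rightarrow> int \<Rightarrow> bool" where
  "yside i j \<longleftrightarrow> j \<le> 0 \<and> \<not> (c (i - 1) \<and> c i)"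

text \<open>The upper edge of the strip, the feet of the tabs and the two ends. Geometrically the
  ends collapse to the poles \<open>x = -1\<close> and \<open>x = 1\<close>; the complex opens each
  pole into a slit, closed by the gluing in \<open>t\<close>.\<close>

definition zside :: "int \<Rightarrow> int \<Rightarrow> bool" where
  "zside i j \<longleftrightarrow> j = N \<or> j = - N \<or> i = 0 \<or> i = M"

definition vert :: "int \<Rightarrow> int \<Rightarrow> int \<Rightarrow> int \<Rightarrow> quad" where
  "vert i j s t = (i, j, if yside i j then 0 else s, if zside i j then 0 else t)"

definition faces :: "quad set" where
  "faces = {(i, j, s, t). cell i j \<and> s \<in> {-1, 1} \<and> t \<in> {-1, 1}}"

fun corners :: "quad \<Rightarrow> quad set" where
  "corners (i, j, s, t) = {vert i j s t, vert (i + 1) j s t, vert i (j + 1) s t, vert (i + 1) (j + 1) s t}"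

definition nodes :: "quad set" where
  "nodes = (\<Union>f\<in>faces. corners f)"

text \<open>Sides point towards increasing coordinates instead of running around the face. Thus the
  two darts of an edge have the same source and the same target (\<open>glue_ends\<close>).\<close>

fun src :: "quad \<times> side \<Rightarrow> quad" where
  "src ((i, j, s, t), Rt) = vert (i + 1) j s t"
| "src ((i, j, s, t), Up) = vert i (j + 1) s t"
| "src ((i, j, s, t), Lf) = vert i j s t"
| "src ((i, j, s, t), Dn) = vert i j s t"

fun tgt :: "quad \<times> side \<Rightarrow> quad" where
  "tgt ((i, j, s, t), Rt) = vert (i + 1) (j + 1) s t"
| "tgt ((i, j, s, t), Up) = vert (i + 1) (j + 1) s t"
| "tgt ((i, j, s, t), Lf) = vert i (j + 1) s t"
| "tgt ((i, j, s, t), Dn) = vert (i + 1) j s t"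

text \<open>A side without a neighbour in its own copy lies on the boundary. The tests on
  \<open>j\<close> separate the flanks of tabs (\<open>s\<close> changes) from the ends of the strip
  (\<open>t\<close> changes), and the lower edge of the strip (\<open>s\<close>) from the foot of a
  tab (\<open>t\<close>).\<close>

fun glue :: "quad \<times> side \<Rightarrow> quad \<times> side" where
  "glue ((i, j, s, t), Rt) =
    (if cell (i + 1) j then ((i + 1, j, s, t), Lf) else if j < 0 then ((i, j, - s, t), Rt) else ((i, j, s, - t), Rt))"
| "glue ((i, j, s, t), Lf) =
    (if cell (i - 1) j then ((i - 1, j, s, t), Rt) else if j < 0 then ((i, j, - s, t), Lf) else ((i, j, s, - t), Lf))"
| "glue ((i, j, s, t), Up) =
    (if cell i (j + 1) then ((i, j + 1, s, t), Dn) else ((i, j, s, - t), Up))"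
| "glue ((i, j, s, t), Dn) =
    (if cell i (j - 1) then ((i, j - 1, s, t), Up) else if j = 0 then ((i, j, - s, t), Dn) else ((i, j, s, - t), Dn))"

definition darts :: "(quad \<times> side) set" where
  "darts = faces \<times> UNIV"

lemma finite_faces: "finite faces"
proof (rule finite_subset)
  show "faces \<subseteq> {0..M} \<times> {-N..N} \<times> {-1, 1} \<times> {-1, 1}"
    unfolding faces_def cell_def by auto
qed simp

lemma finite_darts: "finite darts"
  unfolding darts_def using finite_faces by simp

lemma finite_nodes: "finite nodes"
proof -
  have "finite (corners f)" for f by (cases f) simp
  then show ?thesis unfolding nodes_def using finite_faces by auto
qed

lemma glue_involution:
  assumes "d \<in> darts"
  shows "glue d \<in> darts \<and> glue (glue d) = d \<and> glue d \<noteq> d"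
proof -
  obtain i j s t k where d: "d = ((i, j, s, t), k)" by (metis prod.collapse)
  have st: "s \<in> {-1, 1}" "t \<in> {-1, 1}" and cell: "cell i j"
    using assms unfolding d darts_def faces_def by auto
  have "s \<noteq> - s" "t \<noteq> - t" "- s \<in> {-1, 1}" "- t \<in> {-1, 1}" using st by auto
  then show ?thesis
    using cell st unfolding d darts_def faces_def by (cases k) auto
qed

lemma glue_ends:
  assumes "d \<in> darts"
  shows "src (glue d) = src d" "tgt (glue d) = tgt d"
proof -
  obtain i j s t k where d: "d = ((i, j, s, t), k)" by (metis prod.collapse)
  have cell: "cell i j" using assms unfolding d darts_def faces_def by auto
  show "src (glue d) = src d" "tgt (glue d) = tgt d"
    using cell c[of i] c[of "i + 1"] c[of "i - 1"] N unfolding d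
    by (cases k; auto simp: vert_def yside_def zside_def cell_def)+
qed

lemma ends_in_corners: "src (f, k) \<in> corners f" "tgt (f, k) \<in> corners f"
  by (cases f; cases k; simp)+

text \<open>The sides form a closed walk around the face, which enters \<open>B\<close> as often as
  it leaves it.\<close>

lemma even_face_crossings: "even (card {k. (src (f, k) \<in> B) \<noteq> (tgt (f, k) \<in> B)})"
proof -
  have "card {k. (src (f, k) \<in> B) \<noteq> (tgt (f, k) \<in> B)}
    = (\<Sum>k\<in>UNIV. of_bool ((src (f, k) \<in> B) \<noteq> (tgt (f, k) \<in> B)))"
    by (subst sum_of_bool_eq) simp_all
  moreover obtain i j s t where "f = (i, j, s, t)" by (cases f)
  ultimately show ?thesis by (simp add: UNIV_side del: sum_of_bool_eq)
qed

lemma even_crossings: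
  assumes "C \<subseteq> faces"
  shows "even (card {d \<in> darts. (src d \<in> B) \<noteq> (tgt d \<in> B) \<and> fst d \<in> C})"
proof -
  have "{d \<in> darts. (src d \<in> B) \<noteq> (tgt d \<in> B) \<and> fst d \<in> C}
    = (SIGMA f:C. {k. (src (f, k) \<in> B) \<noteq> (tgt (f, k) \<in> B)})"
    using assms unfolding darts_def by auto
  moreover have "finite C" using assms finite_faces finite_subset by blast
  ultimately show ?thesis
    using even_face_crossings by (simp add: card_SigmaI dvd_sum)
qed

text \<open>Every face is joined within its column to row 0, and then along row 0 to the cell
  \<open>(0, 0)\<close> of its copy. Both boundary types meet in that cell: its lower side changes
  \<open>s\<close> and its left side changes \<open>t\<close>, so the four copies are connected
  there.\<close>

lemma faces_glue_connected:
  assumes "C \<subseteq> faces" "C \<noteq> {}"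
    and closed: "\<And>d. d \<in> darts \<Longrightarrow> fst d \<in> C \<Longrightarrow> fst (glue d) \<in> C"
  shows "C = faces"
proof -
  have step: "f \<in> C \<longleftrightarrow> fst (glue (f, k)) \<in> C" if "f \<in> faces" for f k
  proof -
    have d: "(f, k) \<in> darts" using that unfolding darts_def by simp
    show ?thesis
      using closed[OF d] closed[of "glue (f, k)"] glue_involution[OF d] by auto
  qed
  have row: "(i, j, s, t) \<in> C \<longleftrightarrow> (i, 0, s, t) \<in> C" if "(i, j, s, t) \<in> faces" for i j s t
  proof -
    have "(i, int k, s, t) \<in> faces \<longrightarrow> ((i, int k, s, t) \<in> C \<longleftrightarrow> (i, 0, s, t) \<in> C)" for k
    proof (induction k)
      case (Suc k)
      show ?case
        using Suc step[of "(i, int (Suc k), s, t)" Dn] by (auto simp: faces_def cell_def)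
    qed simp
    moreover have "(i, - int k, s, t) \<in> faces \<longrightarrow> ((i, - int k, s, t) \<in> C \<longleftrightarrow> (i, 0, s, t) \<in> C)" for k
    proof (induction k)
      case (Suc k)
      show ?case
        using Suc step[of "(i, - int (Suc k), s, t)" Up] N by (auto simp: faces_def cell_def)
    qed simp
    ultimately show ?thesis using that by (cases j rule: int_cases2) blast+
  qed
  have f0: "(i, 0, s, t) \<in> faces \<longleftrightarrow> 0 \<le> i \<and> i < M \<and> s \<in> {-1, 1} \<and> t \<in> {-1, 1}" for i s t
    using N by (auto simp: faces_def cell_def)
  have col: "(i, 0, s, t) \<in> C \<longleftrightarrow> (0, 0, s, t) \<in> C" if "(i, 0, s, t) \<in> faces" for i s t
  proof -
    have "(int k, 0, s, t) \<in> faces \<longrightarrow> ((int k, 0, s, t) \<in> C \<longleftrightarrow> (0, 0, s, t) \<in> C)" for k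
    proof (induction k)
      case (Suc k)
      show ?case
        using Suc step[of "(int (Suc k), 0, s, t)" Lf] N by (auto simp: faces_def cell_def)
    qed simp
    then show ?thesis using that f0 by (metis zero_le_imp_eq_int)
  qed
  have c0: "\<not> c 0" using c[of 0] by auto
  have flip: "(0, 0, s, t) \<in> C \<longleftrightarrow> (0, 0, - s, t) \<in> C" "(0, 0, s, t) \<in> C \<longleftrightarrow> (0, 0, s, - t) \<in> C"
    if "s \<in> {-1, 1}" "t \<in> {-1, 1}" for s t
  proof -
    have f: "(0, 0, s, t) \<in> faces" using that f0 M by blast
    show "(0, 0, s, t) \<in> C \<longleftrightarrow> (0, 0, - s, t) \<in> C"
      using step[OF f, of Dn] c0 by (simp add: cell_def)
    show "(0, 0, s, t) \<in> C \<longleftrightarrow> (0, 0, s, - t) \<in> C"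
      using step[OF f, of Lf] by (simp add: cell_def)
  qed
  have base: "(0, 0, s, t) \<in> C \<longleftrightarrow> (0, 0, 1, 1) \<in> C" if "s \<in> {-1, 1}" "t \<in> {-1, 1}" for s t
    using that flip[of 1 1] flip[of "-1" 1] by auto
  have all: "f \<in> C \<longleftrightarrow> (0, 0, 1, 1) \<in> C" if "f \<in> faces" for f
  proof -
    obtain i j s t where f: "f = (i, j, s, t)" by (cases f)
    then have "(i, 0, s, t) \<in> faces" using that N unfolding faces_def cell_def by auto
    then show ?thesis using row[of i j s t] col[of i s t] base[of s t] that f
      unfolding faces_def by auto
  qed
  then show ?thesis using assms(1,2) by blast
qed

section \<open>Edges as chosen darts; connectivity and parity of cuts\<close>

definition edges :: "(quad \<times> side) set" where
  "edges = (SOME E. E \<inter> glue ` E = {} \<and> E \<union> glue ` E = darts)"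

lemma edges: "edges \<inter> glue ` edges = {}" "edges \<union> glue ` edges = darts"
  using someI_ex[OF involution_transversal[OF finite_darts glue_involution]]
  unfolding edges_def by blast+

lemma edges_subset: "edges \<subseteq> darts"
  using edges(2) by blast

lemma finite_edges: "finite edges"
  using edges_subset finite_darts finite_subset by blast

lemma card_edges: "card edges = 2 * card faces"
proof -
  have "inj_on glue edges"
    using glue_involution edges_subset by (intro inj_on_inverseI[of _ glue]) blast
  then have "card (edges \<union> glue ` edges) = card edges + card edges"
    using edges(1) finite_edges by (simp add: card_Un_disjoint card_image)
  then have "card darts = card edges + card edges" unfolding edges(2) .
  moreover have "card darts = card faces * 4"
    unfolding darts_def by (simp add: card_cartesian_product UNIV_side)
  ultimately show ?thesis by simp
qed

lemma edge_ends: "e \<in> edges \<Longrightarrow> src e \<in> nodes \<and> tgt e \<in> nodes"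
  using subsetD[OF edges_subset, of e] ends_in_corners[of "fst e" "snd e"]
  unfolding nodes_def darts_def by fastforce

lemma dart_linked:
  assumes "d \<in> darts" "src d \<in> A" "tgt d \<in> A"
  shows "(src d, tgt d) \<in> linked src tgt {e \<in> edges. src e \<in> A \<and> tgt e \<in> A}"
proof -
  obtain e where e: "e \<in> edges" "d = e \<or> d = glue e" using edges(2) assms(1) by blast
  then have "src d = src e" "tgt d = tgt e" using glue_ends[of e] edges_subset by auto
  then show ?thesis using linked_edge[of e "{e \<in> edges. src e \<in> A \<and> tgt e \<in> A}" src tgt] e assms by simp
qed

lemma corners_linked:
  assumes "f \<in> faces" "corners f \<subseteq> A" "x \<in> corners f" "y \<in> corners f"
  shows "(x, y) \<in> linked src tgt {e \<in> edges. src e \<in> A \<and> tgt e \<in> A}"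
proof -
  let ?L = "linked src tgt {e \<in> edges. src e \<in> A \<and> tgt e \<in> A}"
  obtain i j s t where f: "f = (i, j, s, t)" by (cases f)
  have l: "(src (f, k), tgt (f, k)) \<in> ?L" for k
    using dart_linked[of "(f, k)" A] assms(1,2) ends_in_corners[of f k] unfolding darts_def by auto
  have root: "(vert i j s t, z) \<in> ?L" if "z \<in> corners f" for z
    using that l[of Lf] l[of Dn] linked_trans[of "vert i j s t" "vert (i + 1) j s t" src tgt _ "vert (i + 1) (j + 1) s t"] l[of Rt]
    unfolding f by auto
  show ?thesis using linked_trans[OF linked_sym[OF root[OF assms(3)]] root[OF assms(4)]] .
qed

text \<open>Needed at the poles, which lie in all pieces of an end column. The vertex
  \<open>(k, 0, 0, 0)\<close> has both signs normalised to 0 and so belongs to all four copies; each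
  copy is climbed from there.\<close>

lemma end_column_linked:
  assumes "i = 0 \<or> i = M - 1"
  shows "linked_within src tgt edges (\<Union>f\<in>{f \<in> faces. fst f = i}. corners f)"
proof (rule linked_withinI_root)
  define A where "A = (\<Union>f\<in>{f \<in> faces. fst f = i}. corners f)"
  let ?L = "linked src tgt {e \<in> edges. src e \<in> A \<and> tgt e \<in> A}"
  \<comment> \<open>The outer vertex column of the face column \<open>i\<close>: for the last faces,
    in column \<open>M - 1\<close>, it has index \<open>M\<close>.\<close>
  define k where "k = (if i = 0 then 0 else M)"
  have ci: "\<not> c i" "\<not> c (k - 1)" "\<not> c k" using assms c[of i] c[of "k - 1"] c[of k] unfolding k_def by auto
  have root: "(k, 0, 0, 0) \<in> corners (i, 0, s, t)" for s t
    using assms ci M unfolding k_def by (auto simp: vert_def yside_def zside_def)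
  have sub: "corners (i, j, s, t) \<subseteq> A" if "(i, j, s, t) \<in> faces" for j s t
    unfolding A_def using that by (intro UN_upper) simp
  have tower: "(i, int n, s, t) \<in> faces \<longrightarrow> (\<forall>x\<in>corners (i, int n, s, t). ((k, 0, 0, 0), x) \<in> ?L)" for n s t
  proof (induction n)
    case 0
    have "(i, 0, s, t) \<in> faces \<Longrightarrow> x \<in> corners (i, 0, s, t) \<Longrightarrow> ((k, 0, 0, 0), x) \<in> ?L" for x
      using corners_linked[OF _ sub root] by blast
    then show ?case by (simp del: corners.simps)
  next
    case (Suc n)
    show ?case
    proof (intro impI ballI)
      fix x assume x: "(i, int (Suc n), s, t) \<in> faces" "x \<in> corners (i, int (Suc n), s, t)"
      then have f: "(i, int n, s, t) \<in> faces" by (auto simp: faces_def cell_def)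
      define m where "m = vert i (int n + 1) s t"
      have "m \<in> corners (i, int n, s, t)" unfolding m_def by simp
      then have "((k, 0, 0, 0), m) \<in> ?L" using Suc f by blast
      moreover have "m \<in> corners (i, int (Suc n), s, t)" unfolding m_def by (simp add: add.commute)
      then have "(m, x) \<in> ?L"
        using corners_linked[OF x(1) sub[OF x(1)] _ x(2)] by blast
      ultimately show "((k, 0, 0, 0), x) \<in> ?L" by (rule linked_trans)
    qed
  qed
  fix x assume "x \<in> (\<Union>f\<in>{f \<in> faces. fst f = i}. corners f)"
  then obtain j s t where x: "(i, j, s, t) \<in> faces" "x \<in> corners (i, j, s, t)" by auto
  have "0 \<le> j" using ci x(1) unfolding faces_def cell_def by auto
  then obtain n where j: "j = int n" by (rule nonneg_int_cases)
  have "((k, 0, 0, 0), x) \<in> ?L" using tower[of n s t] x unfolding j by blast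
  then show "((k, 0, 0, 0), x) \<in> linked src tgt {e \<in> edges.
      src e \<in> (\<Union>f\<in>{f \<in> faces. fst f = i}. corners f) \<and> tgt e \<in> (\<Union>f\<in>{f \<in> faces. fst f = i}. corners f)}"
    unfolding A_def .
qed

lemma adjacent_faces_share_corner:
  assumes "f \<in> faces"
  shows "corners f \<inter> corners (fst (glue (f, k))) \<noteq> {}"
  using ends_in_corners(1)[of f k] ends_in_corners(1)[of "fst (glue (f, k))" "snd (glue (f, k))"]
    glue_ends(1)[of "(f, k)"] assms unfolding darts_def by auto

lemma nodes_linked:
  assumes "x \<in> nodes" "y \<in> nodes"
  shows "(x, y) \<in> linked src tgt edges"
proof -
  have "{e \<in> edges. src e \<in> UNIV \<and> tgt e \<in> UNIV} = edges" by simp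
  note cl = corners_linked[where A = UNIV, unfolded this, OF _ subset_UNIV]
  define C where "C = {f \<in> faces. \<forall>z\<in>corners f. (x, z) \<in> linked src tgt edges}"
  have "C = faces"
  proof (rule faces_glue_connected)
    show "C \<subseteq> faces" unfolding C_def by blast
    obtain f where "f \<in> faces" "x \<in> corners f" using assms(1) unfolding nodes_def by blast
    then show "C \<noteq> {}" using cl unfolding C_def by blast
    fix d assume d: "d \<in> darts" "fst d \<in> C"
    let ?g = "fst (glue d)"
    have g: "?g \<in> faces" using glue_involution[OF d(1)] unfolding darts_def by auto
    obtain w where "w \<in> corners (fst d)" "w \<in> corners ?g"
      using adjacent_faces_share_corner[of "fst d" "snd d"] d unfolding C_def by auto
    then show "?g \<in> C"
      using d(2) g cl[OF g] linked_trans[of x w] unfolding C_def by blast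
  qed
  then show ?thesis using assms(2) unfolding nodes_def C_def by blast
qed

lemma boundary_cut_even:
  assumes "C \<subseteq> faces"
  shows "even (card {e \<in> edges. (src e \<in> B) \<noteq> (tgt e \<in> B) \<and> (fst e \<in> C) \<noteq> (fst (glue e) \<in> C)})"
  using even_card_boundary[where D = darts and \<iota> = glue and E = edges and \<phi> = fst and C = C
      and cross = "\<lambda>d. (src d \<in> B) \<noteq> (tgt d \<in> B)"] finite_darts glue_involution edges
    glue_ends even_crossings[OF assms] by simp

lemma edge_dual_connected:
  assumes "C \<subseteq> faces" "C \<noteq> {}" and "\<And>e. e \<in> edges \<Longrightarrow> fst e \<in> C \<longleftrightarrow> fst (glue e) \<in> C"
  shows "C = faces"
proof (rule faces_glue_connected[OF assms(1,2)])
  fix d assume d: "d \<in> darts" "fst d \<in> C"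
  then obtain e where e: "e \<in> edges" "d = e \<or> d = glue e" using edges(2) by blast
  then show "fst (glue d) \<in> C"
    using assms(3)[OF e(1)] d(2) glue_involution[of e] edges_subset by auto
qed

lemma vert_in_nodes:
  assumes "0 \<le> i" "i \<le> M" "- N \<le> j" "j \<le> N" "j < 0 \<longrightarrow> c (i - 1) \<or> c i"
    and "s \<in> {-1, 1}" "t \<in> {-1, 1}"
  shows "vert i j s t \<in> nodes"
proof -
  \<comment> \<open>Normally the vertex is the lower left corner of its cell; on the right end of
    the strip, the right flank of a tab or the upper edge, the cell on its other side is
    taken.\<close>
  define i' where "i' = (if i < M \<and> (j < 0 \<longrightarrow> c i) then i else i - 1)"
  define j' where "j' = (if j < N then j else j - 1)"
  have "(i', j', s, t) \<in> faces"
    using assms M N c[of i] c[of "i - 1"] unfolding faces_def cell_def i'_def j'_def by auto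
  moreover have "vert i j s t \<in> corners (i', j', s, t)"
    unfolding i'_def j'_def by auto
  ultimately show ?thesis unfolding nodes_def by blast
qed

section \<open>Counting vertices column by column\<close>

definition column :: "int \<Rightarrow> quad set" where
  "column i = {v \<in> nodes. fst v = i}"

text \<open>
  Off the ends, a column of vertices splits into a left and a right half, which belong to the adjacent
  columns of faces; a vertex column where \<open>c\<close> changes falls short by one.
\<close>

definition half_column :: "int \<Rightarrow> nat" where
  "half_column i = 2 * nat N * (if c i then 2 else 1)"

lemma card_faces: "card faces = (\<Sum>i\<in>{0..<M}. 2 * half_column i)"
proof -
  have "faces = (SIGMA i:{0..<M}. {(if c i then - N else 0)..<N} \<times> {-1, 1} \<times> {-1, 1})"
    using N unfolding faces_def cell_def by (auto split: if_splits)
  then show ?thesis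
    using N by (auto simp: card_SigmaI card_cartesian_product half_column_def nat_add_distrib nat_mult_distrib intro!: sum.cong)
qed

text \<open>With a tab on both sides, on neither side, or on one side, the column has at least 8N,
  4N or 6N - 1 vertices. The missing vertex is at a lower corner of a tab, where both signs are
  normalised and the four copies share one vertex.\<close>

lemma card_column_ge:
  assumes "0 < i" "i < M"
  shows "half_column (i - 1) + half_column i \<le> card (column i) + (if c (i - 1) = c i then 0 else 1)"
proof -
  let ?S = "{-1, 1 :: int}"
  have fin: "finite (column i)" unfolding column_def using finite_nodes by auto
  have inc: "(i, j, (if yside i j then 0 else s), (if zside i j then 0 else t)) \<in> column i"
    if "- N \<le> j" "j \<le> N" "j < 0 \<longrightarrow> c (i - 1) \<or> c i" "s \<in> ?S" "t \<in> ?S" for j s t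
    using vert_in_nodes[of i j s t] that assms unfolding column_def vert_def by auto
  have z: "zside i j \<longleftrightarrow> j = N \<or> j = - N" for j using assms unfolding zside_def by auto
  consider "c (i - 1) \<and> c i" | "\<not> c (i - 1) \<and> \<not> c i" | "c (i - 1) \<noteq> c i" by blast
  then show ?thesis
  proof cases
    case 1
    let ?A = "({- N + 1..N - 1} \<times> ?S \<times> ?S) \<union> ({- N, N} \<times> ?S \<times> {0})"
    have "{i} \<times> ?A \<subseteq> column i"
    proof
      fix v assume "v \<in> {i} \<times> ?A"
      then show "v \<in> column i"
        using inc[of "fst (snd v)" "fst (snd (snd v))" "snd (snd (snd v))"]
          inc[of "fst (snd v)" "fst (snd (snd v))" 1] 1 z N
        by (auto simp: yside_def)
    qed
    then have "card ({i} \<times> ?A) \<le> card (column i)" using fin card_mono by blast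
    moreover have "card ?A = card ({- N + 1..N - 1} \<times> ?S \<times> ?S) + card ({- N, N} \<times> ?S \<times> {0::int})"
      by (intro card_Un_disjoint) auto
    ultimately show ?thesis using 1 N by (auto simp: card_cartesian_product half_column_def)
  next
    case 2
    let ?A = "({1..N - 1} \<times> ?S \<times> ?S) \<union> (({N} \<times> ?S \<times> {0}) \<union> ({0} \<times> {0} \<times> ?S))"
    have "{i} \<times> ?A \<subseteq> column i"
    proof
      fix v assume "v \<in> {i} \<times> ?A"
      then show "v \<in> column i"
        using inc[of "fst (snd v)" "fst (snd (snd v))" "snd (snd (snd v))"]
          inc[of "fst (snd v)" "fst (snd (snd v))" 1] inc[of "fst (snd v)" 1 "snd (snd (snd v))"] 2 z N
        by (auto simp: yside_def)
    qed
    then have "card ({i} \<times> ?A) \<le> card (column i)" using fin card_mono by blast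
    moreover have "card ?A = card ({1..N - 1} \<times> ?S \<times> ?S) + card (({N} \<times> ?S \<times> {0}) \<union> ({0} \<times> {0} \<times> ?S))"
      using N by (intro card_Un_disjoint) auto
    moreover have "card (({N} \<times> ?S \<times> {0}) \<union> ({0} \<times> {0} \<times> ?S)) = card ({N} \<times> ?S \<times> {0::int}) + card ({0::int} \<times> {0::int} \<times> ?S)"
      using N by (intro card_Un_disjoint) auto
    ultimately show ?thesis using 2 N by (auto simp: card_cartesian_product half_column_def)
  next
    case 3
    let ?A = "({1..N - 1} \<times> ?S \<times> ?S) \<union> (({N} \<times> ?S \<times> {0}) \<union> (({- N + 1..0} \<times> {0} \<times> ?S) \<union> {(- N, 0, 0)}))"
    have "{i} \<times> ?A \<subseteq> column i"
    proof
      fix v assume "v \<in> {i} \<times> ?A"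
      then show "v \<in> column i"
        using inc[of "fst (snd v)" "fst (snd (snd v))" "snd (snd (snd v))"] inc[of "fst (snd v)" 1 1]
          inc[of "fst (snd v)" "fst (snd (snd v))" 1] inc[of "fst (snd v)" 1 "snd (snd (snd v))"] 3 z N
        by (auto simp: yside_def)
    qed
    then have "card ({i} \<times> ?A) \<le> card (column i)" using fin card_mono by blast
    then have "card ?A \<le> card (column i)" by (simp only: card_cartesian_product_singleton)
    moreover have "card ?A = card ({1..N - 1} \<times> ?S \<times> ?S) + (card ({N} \<times> ?S \<times> {0::int}) +
        (card ({- N + 1..0} \<times> {0::int} \<times> ?S) + card {(- N, 0::int, 0::int)}))"
      using N by (subst card_Un_disjoint; auto)+
    moreover have "card ({1..N - 1} \<times> ?S \<times> ?S) = 4 * nat (N - 1)" "card ({N} \<times> ?S \<times> {0::int}) = 2"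
      "card ({- N + 1..0} \<times> {0::int} \<times> ?S) = 2 * nat N" "card {(- N, 0::int, 0::int)} = 1"
      by (simp_all add: card_cartesian_product)
    ultimately have "6 * nat N \<le> card (column i) + 1" using N by linarith
    then show ?thesis using 3 N unfolding half_column_def by auto
  qed
qed

lemma card_outer_column_ge:
  assumes "i = 0 \<or> i = M"
  shows "2 * nat N + 1 \<le> card (column i)"
proof -
  let ?S = "{-1, 1 :: int}"
  have fin: "finite (column i)" unfolding column_def using finite_nodes by auto
  have ci: "\<not> c (i - 1)" "\<not> c i" using c[of i] c[of "i - 1"] assms by auto
  have inc: "(i, j, (if yside i j then 0 else s), 0) \<in> column i"
    if "0 \<le> j" "j \<le> N" "s \<in> ?S" for j s
    using vert_in_nodes[of i j s 1] that assms M unfolding column_def vert_def zside_def by auto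
  let ?A = "({1..N} \<times> ?S \<times> {0}) \<union> {(0, 0, 0 :: int)}"
  have "{i} \<times> ?A \<subseteq> column i"
  proof
    fix v assume "v \<in> {i} \<times> ?A"
    then show "v \<in> column i"
      using inc[of "fst (snd v)" "fst (snd (snd v))"] inc[of 0 1] ci N
      by (auto simp: yside_def)
  qed
  then have "card ({i} \<times> ?A) \<le> card (column i)" using fin card_mono by blast
  moreover have "card ?A = card ({1..N} \<times> ?S \<times> {0::int}) + 1"
    by (subst card_Un_disjoint) auto
  ultimately show ?thesis using N by (auto simp: card_cartesian_product)
qed

text \<open>Half columns add up to \<open>card faces\<close>, except that the two outermost vertex
  columns contribute 2N + 1 each where one half column would be 2N; this is the surplus 2. As there
  are twice as many edges as faces, the statement bounds the Euler characteristic from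
  below.\<close>

lemma card_nodes_ge:
  "card faces + 2 \<le> card nodes + card {i \<in> {1..<M}. c (i - 1) \<noteq> c i}"
proof -
  have vc: "(\<Sum>i\<in>{0..M}. card (column i)) \<le> card nodes"
    by (rule pairwise_disjoint_card_sum_le) (auto simp: column_def finite_nodes)
  have split: "{0..M} = insert 0 (insert M {1..<M})" using M by auto
  have "(\<Sum>i\<in>{0..M}. card (column i)) = card (column 0) + (card (column M) + (\<Sum>i\<in>{1..<M}. card (column i)))"
    unfolding split using M by (subst sum.insert; simp)+
  moreover have "(\<Sum>i\<in>{1..<M}. half_column (i - 1) + half_column i) \<le> (\<Sum>i\<in>{1..<M}. card (column i) + (if c (i - 1) = c i then 0 else 1))"
    using card_column_ge by (intro sum_mono) auto
  moreover have "(\<Sum>i\<in>{1..<M}. (if c (i - 1) = c i then 0 else 1)) = card {i \<in> {1..<M}. c (i - 1) \<noteq> c i}"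
    by (simp add: sum.If_cases Int_def)
  moreover have "(\<Sum>i\<in>{1..<M}. half_column (i - 1)) + half_column (M - 1) = (\<Sum>i\<in>{0..<M}. half_column i)"
  proof -
    have "(\<Sum>i\<in>{1..<M}. half_column (i - 1)) = (\<Sum>i\<in>{0..<M - 1}. half_column i)"
      by (rule sum.reindex_bij_witness[of _ "\<lambda>i. i + 1" "\<lambda>i. i - 1"]) auto
    moreover have "{0..<M} = insert (M - 1) {0..<M - 1}" using M by auto
    ultimately show ?thesis by simp
  qed
  moreover have "(\<Sum>i\<in>{1..<M}. half_column i) + half_column 0 = (\<Sum>i\<in>{0..<M}. half_column i)"
  proof -
    have "{0..<M} = insert 0 {1..<M}" using M by auto
    then show ?thesis by simp
  qed
  moreover have "half_column 0 = 2 * nat N" "half_column (M - 1) = 2 * nat N"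
    using c[of 0] c[of "M - 1"] unfolding half_column_def by auto
  moreover have "card faces = (\<Sum>i\<in>{0..<M}. half_column i) + (\<Sum>i\<in>{0..<M}. half_column i)"
    unfolding card_faces by (simp add: mult_2 sum.distrib)
  ultimately show ?thesis
    using vc card_outer_column_ge[of 0] card_outer_column_ge[of M] by (simp add: sum.distrib)
qed

end

section \<open>Quadrangulations of the sphere with handles\<close>

text \<open>
  The planes \<open>y = 0\<close> and \<open>z = 0\<close> cut the surface into four discs, one for each choice of the signs of
  \<open>y\<close> and \<open>z\<close>. On such a disc \<open>x\<close> and \<open>level\<close> are coordinates: \<open>level\<close> is nonnegative on the sphere and
  nonpositive on the tubes, \<open>y\<^sup>2 = chord + max 0 level\<close> and \<open>z\<^sup>2 = gap - \<bar>level\<bar>\<close>, where \<open>chord\<close> is the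
  squared half-length of the chord of the hole at \<open>x\<close> and vanishes outside the holes. The factor
  \<open>hscale h\<close>, chosen also for \<open>h = 0\<close>, makes \<open>4 * q + 1\<close> and \<open>4 * q + 3\<close> the ends of the \<open>q\<close>-th hole in the
  coordinate \<open>hscale h * (x + 1)\<close>.
\<close>

definition hscale :: "nat \<Rightarrow> nat" where
  "hscale h = (if h = 0 then 1 else 2 * h)"

text \<open>For \<open>h > 0\<close>, the signed distance of \<open>x\<close> from the centre of the
  \<open>q\<close>-th hole, measured in radii of the hole.\<close>

definition offset :: "nat \<Rightarrow> nat \<Rightarrow> real \<Rightarrow> real" where
  "offset h q x = real (hscale h) * (x + 1) - (4 * real q + 2)"

text \<open>The holes are disjoint, so at most one summand is nonzero; the sum of truncated terms is
  continuous in \<open>x\<close> without case distinction.\<close>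

definition chord :: "nat \<Rightarrow> real \<Rightarrow> real" where
  "chord h x = (\<Sum>q<h. max 0 (1 - (offset h q x)\<^sup>2)) / (real (hscale h))\<^sup>2"

definition gap :: "nat \<Rightarrow> real \<Rightarrow> real" where
  "gap h x = 1 - x\<^sup>2 - chord h x"

text \<open>On the surface one of the two brackets vanishes: the second on the sphere, the first on
  a tube. Hence one continuous formula serves both parts and tells them apart by its sign.\<close>

definition level :: "nat \<Rightarrow> complex \<times> real \<Rightarrow> real" where
  "level h p = ((Im (fst p))\<^sup>2 - chord h (Re (fst p))) - (1 - (norm p)\<^sup>2)"

lemma hscale_pos: "0 < hscale h"
  by (simp add: hscale_def)

lemma chord_nonneg: "0 \<le> chord h x"
  unfolding chord_def by (intro divide_nonneg_nonneg sum_nonneg) auto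

lemma chord_hole:
  assumes "q < h" "\<bar>offset h q x\<bar> \<le> 1"
  shows "chord h x = (1 - (offset h q x)\<^sup>2) / (real (hscale h))\<^sup>2"
proof -
  have "max 0 (1 - (offset h k x)\<^sup>2) = 0" if "k < h" "k \<noteq> q" for k
  proof -
    have "1 \<le> \<bar>real k - real q\<bar>" using that(2) by linarith
    moreover have "offset h k x = offset h q x + 4 * (real q - real k)" unfolding offset_def by simp
    ultimately have "1 \<le> \<bar>offset h k x\<bar>" using assms(2) by (smt (verit))
    then have "1 \<le> (offset h k x)\<^sup>2" by (metis one_le_power power2_abs)
    then show ?thesis by simp
  qed
  then have "(\<Sum>k<h. max 0 (1 - (offset h k x)\<^sup>2)) = (\<Sum>k\<in>{q}. max 0 (1 - (offset h k x)\<^sup>2))"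
    using assms(1) by (intro sum.mono_neutral_right) auto
  moreover have "(offset h q x)\<^sup>2 \<le> 1" using assms(2) by (simp add: abs_square_le_1)
  ultimately show ?thesis unfolding chord_def by simp
qed

lemma chord_eq_0:
  assumes "\<And>q. q < h \<Longrightarrow> 1 \<le> \<bar>offset h q x\<bar>"
  shows "chord h x = 0"
proof -
  have "max 0 (1 - (offset h q x)\<^sup>2) = 0" if "q < h" for q
    using assms[OF that] by (metis diff_le_0_iff_le max.absorb1 one_le_power power2_abs)
  then show ?thesis unfolding chord_def by simp
qed

lemma chord_pos:
  assumes "q < h" "\<bar>offset h q x\<bar> < 1"
  shows "0 < chord h x"
  using chord_hole[of q h x] assms hscale_pos[of h] abs_square_less_1[of "offset h q x"] by simp

text \<open>The holes lie in the open unit disc. Over a hole with centre \<open>k / L\<close>, the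
  boundary points above \<open>x\<close> have squared norm \<open>x^2 + chord h x\<close>; times
  \<open>L^2\<close> this is \<open>k^2 + 2 * u * k + 1\<close>, at most
  \<open>(\<bar>k\<bar> + 1)^2\<close>, and \<open>\<bar>k\<bar> \<le> L - 2\<close>.\<close>

lemma gap_pos:
  assumes "\<bar>x\<bar> < 1"
  shows "0 < gap h x"
proof (cases "\<exists>q<h. \<bar>offset h q x\<bar> \<le> 1")
  case False
  then have "chord h x = 0" by (intro chord_eq_0) (auto simp: not_le intro: less_imp_le)
  then show ?thesis using assms abs_square_less_1[of x] unfolding gap_def by simp
next
  case True
  then obtain q where q: "q < h" "\<bar>offset h q x\<bar> \<le> 1" by blast
  define L where "L = real (hscale h)"
  define u where "u = offset h q x"
  define k where "k = 4 * real q + 2 - L"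
  have L: "L = 2 * real h" "0 < L" using q(1) unfolding L_def hscale_def by auto
  have qh: "real q + 1 \<le> real h" using q(1) by simp
  have k: "\<bar>k\<bar> \<le> L - 2" using qh unfolding k_def L(1) by (auto simp: abs_le_iff)
  have x: "L * x = u + k" unfolding u_def k_def offset_def L_def by (simp add: algebra_simps)
  have "u * k \<le> \<bar>k\<bar>"
  proof -
    have "u * k \<le> \<bar>u\<bar> * \<bar>k\<bar>" by (metis abs_ge_self abs_mult)
    also have "\<dots> \<le> 1 * \<bar>k\<bar>" using q(2) unfolding u_def by (intro mult_right_mono) auto
    finally show ?thesis by simp
  qed
  then have "(L * x)\<^sup>2 + (1 - u\<^sup>2) \<le> (\<bar>k\<bar> + 1)\<^sup>2" unfolding x by (simp add: power2_eq_square algebra_simps)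
  also have "\<dots> < L\<^sup>2" using k by (intro power_strict_mono) auto
  finally have "(L * x)\<^sup>2 + (1 - u\<^sup>2) < L\<^sup>2" .
  then have "x\<^sup>2 + (1 - u\<^sup>2) / L\<^sup>2 < 1" using L(2) by (simp add: field_simps)
  then show ?thesis using chord_hole[OF q] unfolding gap_def u_def L_def by simp
qed

lemma continuous_on_chord: "continuous_on UNIV (chord h)"
  unfolding chord_def offset_def using hscale_pos[of h] by (intro continuous_intros) auto

lemma norm_square_complex_real: "(norm (p :: complex \<times> real))\<^sup>2 = (Re (fst p))\<^sup>2 + (Im (fst p))\<^sup>2 + (snd p)\<^sup>2"
  by (cases p) (simp add: norm_Pair cmod_power2)

lemma dist_handle_centre:
  assumes "q < h"
  shows "(dist (handle_centre h q) w)\<^sup>2 - (handle_radius h)\<^sup>2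
    = (Im w)\<^sup>2 - (1 - (offset h q (Re w))\<^sup>2) / (real (hscale h))\<^sup>2"
proof -
  have h: "0 < real h" using assms by simp
  have "(dist (handle_centre h q) w)\<^sup>2 = (Re w - ((2 * real q + 1) / real h - 1))\<^sup>2 + (Im w)\<^sup>2"
    unfolding handle_centre_def dist_norm cmod_power2 by (simp add: power2_commute)
  moreover have "Re w - ((2 * real q + 1) / real h - 1) = offset h q (Re w) / real (hscale h)"
    using h unfolding offset_def hscale_def by (simp add: field_simps)
  moreover have "handle_radius h = 1 / real (hscale h)"
    using h unfolding handle_radius_def hscale_def by simp
  ultimately show ?thesis by (simp add: power_divide diff_divide_distrib)
qed

lemma surface_cases:
  assumes "p \<in> sphere_with_handles h"
  shows "chord h (Re (fst p)) \<le> (Im (fst p))\<^sup>2" "norm p \<le> 1"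
    "norm p = 1 \<or> (Im (fst p))\<^sup>2 = chord h (Re (fst p)) \<and> (\<exists>q<h. \<bar>offset h q (Re (fst p))\<bar> \<le> 1)"
proof -
  obtain w z where p: "p = (w, z)" by (cases p)
  have r: "0 \<le> handle_radius h" unfolding handle_radius_def by simp
  consider "norm p = 1" "\<forall>q<h. handle_radius h \<le> dist (handle_centre h q) w"
    | q where "norm p \<le> 1" "q < h" "dist (handle_centre h q) w = handle_radius h"
    using assms unfolding p sphere_with_handles_def by (auto simp: not_less)
  then have "chord h (Re w) \<le> (Im w)\<^sup>2 \<and> norm p \<le> 1 \<and>
    (norm p = 1 \<or> (Im w)\<^sup>2 = chord h (Re w) \<and> (\<exists>q<h. \<bar>offset h q (Re w)\<bar> \<le> 1))"
  proof cases
    case 1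
    have "chord h (Re w) \<le> (Im w)\<^sup>2"
    proof (cases "\<exists>q<h. \<bar>offset h q (Re w)\<bar> \<le> 1")
      case True
      then obtain q where q: "q < h" "\<bar>offset h q (Re w)\<bar> \<le> 1" by blast
      have "(handle_radius h)\<^sup>2 \<le> (dist (handle_centre h q) w)\<^sup>2" using 1 q r by (intro power_mono) auto
      then show ?thesis using dist_handle_centre[OF q(1), of w] chord_hole[OF q] by linarith
    next
      case False
      then have "chord h (Re w) = 0" by (intro chord_eq_0) (auto simp: not_le intro: less_imp_le)
      then show ?thesis by simp
    qed
    then show ?thesis using 1 by simp
  next
    case (2 q)
    have eq: "(Im w)\<^sup>2 = (1 - (offset h q (Re w))\<^sup>2) / (real (hscale h))\<^sup>2"
      using dist_handle_centre[OF 2(2), of w] 2(3) by simp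
    then have "0 \<le> (1 - (offset h q (Re w))\<^sup>2) / (real (hscale h))\<^sup>2" by (metis zero_le_power2)
    then have "(offset h q (Re w))\<^sup>2 \<le> 1" using hscale_pos[of h] by (simp add: zero_le_divide_iff)
    then have o: "\<bar>offset h q (Re w)\<bar> \<le> 1" by (simp add: abs_square_le_1)
    then show ?thesis using chord_hole[OF 2(2) o] eq 2 by auto
  qed
  then show "chord h (Re (fst p)) \<le> (Im (fst p))\<^sup>2" "norm p \<le> 1"
    "norm p = 1 \<or> (Im (fst p))\<^sup>2 = chord h (Re (fst p)) \<and> (\<exists>q<h. \<bar>offset h q (Re (fst p))\<bar> \<le> 1)"
    unfolding p by auto
qed

lemma surface_coordinates:
  assumes "p \<in> sphere_with_handles h"
  shows "(Im (fst p))\<^sup>2 = chord h (Re (fst p)) + max 0 (level h p)"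
    and "(snd p)\<^sup>2 = gap h (Re (fst p)) - \<bar>level h p\<bar>"
    and "level h p < 0 \<Longrightarrow> \<exists>q<h. \<bar>offset h q (Re (fst p))\<bar> \<le> 1"
    and "\<bar>Re (fst p)\<bar> \<le> 1"
proof -
  note s = surface_cases[OF assms]
  have "(norm p)\<^sup>2 \<le> 1" using s(2) by (simp add: power_le_one)
  then show "(Im (fst p))\<^sup>2 = chord h (Re (fst p)) + max 0 (level h p)"
    "(snd p)\<^sup>2 = gap h (Re (fst p)) - \<bar>level h p\<bar>"
    "level h p < 0 \<Longrightarrow> \<exists>q<h. \<bar>offset h q (Re (fst p))\<bar> \<le> 1"
    using s(1,3) norm_square_complex_real[of p] unfolding level_def gap_def by auto
  have "(Re (fst p))\<^sup>2 \<le> 1" using \<open>(norm p)\<^sup>2 \<le> 1\<close> norm_square_complex_real[of p]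
    by (smt (verit) zero_le_power2)
  then show "\<bar>Re (fst p)\<bar> \<le> 1" by (simp add: abs_square_le_1)
qed

lemma compact_sphere_with_handles: "compact (sphere_with_handles h)"
proof -
  have eq: "sphere_with_handles h =
    (sphere 0 1 \<inter> (\<Inter>i\<in>{..<h}. {p. handle_radius h \<le> dist (handle_centre h i) (fst p)})) \<union>
    (cball 0 1 \<inter> (\<Union>i\<in>{..<h}. {p. dist (handle_centre h i) (fst p) = handle_radius h}))"
    unfolding sphere_with_handles_def by (auto simp: not_less)
  have "closed {p :: complex \<times> real. handle_radius h \<le> dist (handle_centre h i) (fst p)}"
    "closed {p :: complex \<times> real. dist (handle_centre h i) (fst p) = handle_radius h}" for i
    by (intro closed_Collect_le closed_Collect_eq continuous_intros)+
  then have "closed (\<Inter>i\<in>{..<h}. {p :: complex \<times> real. handle_radius h \<le> dist (handle_centre h i) (fst p)})"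
    "closed (\<Union>i\<in>{..<h}. {p :: complex \<times> real. dist (handle_centre h i) (fst p) = handle_radius h})"
    by (intro closed_INT closed_UN; auto)+
  then show ?thesis unfolding eq by (intro compact_Un compact_Int_closed) auto
qed

lemma continuous_on_level: "continuous_on UNIV (level h)"
proof -
  have "continuous_on UNIV (\<lambda>p :: complex \<times> real. chord h (Re (fst p)))"
    by (rule continuous_on_compose2[OF continuous_on_chord]) (auto intro!: continuous_intros)
  then show ?thesis unfolding level_def by (intro continuous_intros)
qed

lemma continuous_on_gap: "continuous_on UNIV (gap h)"
  unfolding gap_def by (intro continuous_intros continuous_on_chord)

text \<open>A unit of the coordinate \<open>hscale h * (x + 1)\<close> is divided into
  \<open>N\<close> columns, so the ends \<open>4 * q + 1\<close> and \<open>4 * q + 3\<close> of a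
  hole are grid lines for every \<open>N\<close>.\<close>

definition hole :: "nat \<Rightarrow> nat \<Rightarrow> int \<Rightarrow> bool" where
  "hole h N i \<longleftrightarrow> (\<exists>q<h. (4 * int q + 1) * int N \<le> i \<and> i < (4 * int q + 3) * int N)"

definition width :: "nat \<Rightarrow> nat \<Rightarrow> int" where
  "width h N = 2 * int (hscale h) * int N"

lemma hole_bounds:
  assumes "0 < N" "hole h N i"
  shows "0 < i \<and> i < width h N - 1"
proof -
  obtain q where q: "q < h" "(4 * int q + 1) * int N \<le> i" "i < (4 * int q + 3) * int N"
    using assms(2) unfolding hole_def by blast
  have "1 * int N \<le> (4 * int q + 1) * int N" by (intro mult_right_mono) auto
  moreover have "(4 * int q + 3) * int N \<le> (4 * int h - 1) * int N"
    using q(1) by (intro mult_right_mono) auto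
  moreover have "width h N = (4 * int h - 1) * int N + int N"
    using q(1) unfolding width_def hscale_def by (simp add: algebra_simps)
  ultimately show ?thesis using q assms(1) by linarith
qed

lemma strip_grid: "0 < N \<Longrightarrow> strip (width h N) (int N) (hole h N)"
  using hole_bounds[of N h] hscale_pos[of h] by unfold_locales (auto simp: width_def)

text \<open>Consecutive holes are \<open>2 * N\<close> columns apart, so adjacent columns in holes
  belong to the same hole.\<close>

lemma inner_hole_iff:
  assumes "0 < N"
  shows "hole h N (i - 1) \<and> hole h N i \<longleftrightarrow> (\<exists>q<h. (4 * int q + 1) * int N < i \<and> i < (4 * int q + 3) * int N)"
proof
  assume "hole h N (i - 1) \<and> hole h N i"
  then obtain q k where q: "q < h" "(4 * int q + 1) * int N \<le> i" "i < (4 * int q + 3) * int N"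
    and k: "k < h" "(4 * int k + 1) * int N \<le> i - 1" "i - 1 < (4 * int k + 3) * int N"
    unfolding hole_def by blast
  show "\<exists>q<h. (4 * int q + 1) * int N < i \<and> i < (4 * int q + 3) * int N"
  proof (cases "i = (4 * int q + 1) * int N")
    case True
    then have "(4 * int k + 1) * int N < (4 * int q + 1) * int N" using k by simp
    then have "4 * int k + 1 < 4 * int q + 1" using assms by (simp add: mult_less_cancel_right)
    then have "4 * int k + 3 \<le> 4 * int q - 1" by presburger
    then have "(4 * int k + 3) * int N \<le> (4 * int q - 1) * int N" by (intro mult_right_mono) auto
    also have "\<dots> = (4 * int q + 1) * int N - 2 * int N" by (simp add: algebra_simps)
    finally show ?thesis using True k assms by linarith
  qed (use q in force)
next
  assume "\<exists>q<h. (4 * int q + 1) * int N < i \<and> i < (4 * int q + 3) * int N"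
  then show "hole h N (i - 1) \<and> hole h N i" unfolding hole_def by force
qed

lemma card_hole_ends:
  assumes "0 < N"
  shows "card {i \<in> {1..<width h N}. hole h N (i - 1) \<noteq> hole h N i} \<le> 2 * h"
proof -
  let ?A = "(\<lambda>q. (4 * int q + 1) * int N) ` {..<h} \<union> (\<lambda>q. (4 * int q + 3) * int N) ` {..<h}"
  have "{i \<in> {1..<width h N}. hole h N (i - 1) \<noteq> hole h N i} \<subseteq> ?A"
  proof
    fix i assume i: "i \<in> {i \<in> {1..<width h N}. hole h N (i - 1) \<noteq> hole h N i}"
    then have "\<not> (hole h N (i - 1) \<and> hole h N i)" by blast
    then have n: "\<not> ((4 * int q + 1) * int N < i \<and> i < (4 * int q + 3) * int N)" if "q < h" for q
      using that unfolding inner_hole_iff[OF assms] by blast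
    from i consider q where "q < h" "(4 * int q + 1) * int N \<le> i" "i < (4 * int q + 3) * int N"
      | q where "q < h" "(4 * int q + 1) * int N \<le> i - 1" "i - 1 < (4 * int q + 3) * int N"
      unfolding hole_def by blast
    then show "i \<in> ?A"
    proof cases
      case (1 q)
      then have "i = (4 * int q + 1) * int N" using n[of q] by linarith
      then show ?thesis using 1(1) by blast
    next
      case (2 q)
      then have "i = (4 * int q + 3) * int N" using n[of q] by linarith
      then show ?thesis using 2(1) by blast
    qed
  qed
  then have "card {i \<in> {1..<width h N}. hole h N (i - 1) \<noteq> hole h N i} \<le> card ?A"
    by (intro card_mono) auto
  also have "\<dots> \<le> card {..<h} + card {..<h}"
    by (intro order_trans[OF card_Un_le] add_mono card_image_le) auto
  finally show ?thesis by simp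
qed

lemma hole_offset:
  assumes "0 < N" "q < h"
  shows "real_of_int ((4 * int q + 1) * int N) < real N * (real (hscale h) * (x + 1)) \<and>
      real N * (real (hscale h) * (x + 1)) < real_of_int ((4 * int q + 3) * int N)
    \<longleftrightarrow> \<bar>offset h q x\<bar> < 1"
    and "real_of_int ((4 * int q + 1) * int N) \<le> real N * (real (hscale h) * (x + 1)) \<and>
      real N * (real (hscale h) * (x + 1)) \<le> real_of_int ((4 * int q + 3) * int N)
    \<longleftrightarrow> \<bar>offset h q x\<bar> \<le> 1"
proof -
  have N: "0 < real N" using assms by simp
  have *: "real_of_int ((4 * int q + 1) * int N) = real N * (4 * real q + 1)"
    "real_of_int ((4 * int q + 3) * int N) = real N * (4 * real q + 3)" by (simp_all add: algebra_simps)
  show "real_of_int ((4 * int q + 1) * int N) < real N * (real (hscale h) * (x + 1)) \<and>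
      real N * (real (hscale h) * (x + 1)) < real_of_int ((4 * int q + 3) * int N)
    \<longleftrightarrow> \<bar>offset h q x\<bar> < 1"
    unfolding * mult_less_cancel_left_pos[OF N] offset_def abs_less_iff by linarith
  show "real_of_int ((4 * int q + 1) * int N) \<le> real N * (real (hscale h) * (x + 1)) \<and>
      real N * (real (hscale h) * (x + 1)) \<le> real_of_int ((4 * int q + 3) * int N)
    \<longleftrightarrow> \<bar>offset h q x\<bar> \<le> 1"
    unfolding * mult_le_cancel_left_pos[OF N] offset_def abs_le_iff by linarith
qed

section \<open>Pieces of the surface and their incidences\<close>

definition abscissa :: "nat \<Rightarrow> complex \<times> real \<Rightarrow> real" where
  "abscissa h p = real (hscale h) * (Re (fst p) + 1)"

text \<open>
  The rows are compared after multiplication by \<open>gap\<close>, so that pieces are closed; at the two poles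
  \<open>x = 1\<close> and \<open>x = - 1\<close>, where \<open>gap\<close> vanishes, the point lies in every piece of its column.
\<close>

definition piece :: "nat \<Rightarrow> nat \<Rightarrow> quad \<Rightarrow> (complex \<times> real) set" where
  "piece h N = (\<lambda>(i, j, s, t). {p \<in> sphere_with_handles h.
     real_of_int i \<le> real N * abscissa h p \<and> real N * abscissa h p \<le> real_of_int i + 1 \<and>
     real_of_int j * gap h (Re (fst p)) \<le> real N * level h p \<and>
     real N * level h p \<le> (real_of_int j + 1) * gap h (Re (fst p)) \<and>
     0 \<le> real_of_int s * Im (fst p) \<and> 0 \<le> real_of_int t * snd p})"

lemma continuous_on_gap_Re: "continuous_on UNIV (\<lambda>p :: complex \<times> real. gap h (Re (fst p)))"
  by (rule continuous_on_compose2[OF continuous_on_gap]) (auto intro!: continuous_intros)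

lemma closed_piece: "closed (piece h N f)"
proof -
  obtain i j s t where f: "f = (i, j, s, t)" by (cases f)
  have "piece h N f = sphere_with_handles h \<inter>
      {p. real_of_int i \<le> real N * abscissa h p} \<inter> {p. real N * abscissa h p \<le> real_of_int i + 1} \<inter>
      {p. real_of_int j * gap h (Re (fst p)) \<le> real N * level h p} \<inter>
      {p. real N * level h p \<le> (real_of_int j + 1) * gap h (Re (fst p))} \<inter>
      {p. 0 \<le> real_of_int s * Im (fst p)} \<inter> {p. 0 \<le> real_of_int t * snd p}"
    unfolding piece_def f by auto
  also have "closed \<dots>"
    using compact_imp_closed[OF compact_sphere_with_handles[of h]] unfolding abscissa_def
    by (intro closed_Int closed_Collect_le continuous_intros continuous_on_gap_Re continuous_on_level) auto
  finally show ?thesis .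
qed

text \<open>The grid vertex \<open>(i, j)\<close> enters as \<open>(i / N, j / N)\<close>, which
  ranges over a compact set independent of \<open>N\<close>; this permits limits. As in
  \<open>piece\<close>, the row condition is multiplied by \<open>gap\<close>.\<close>

definition grid_near :: "nat \<Rightarrow> nat \<Rightarrow> real \<Rightarrow> real \<Rightarrow> complex \<times> real \<Rightarrow> bool" where
  "grid_near h N \<alpha> \<tau> p \<longleftrightarrow> p \<in> sphere_with_handles h \<and> \<bar>abscissa h p - \<alpha>\<bar> \<le> 1 / real N \<and>
     \<bar>level h p - \<tau> * gap h (Re (fst p))\<bar> \<le> gap h (Re (fst p)) / real N"

lemma unit_interval_containing:
  fixes u :: real and a b :: int
  assumes "real_of_int a \<le> u" "u \<le> real_of_int b" "a < b"
  shows "\<exists>i. a \<le> i \<and> i < b \<and> real_of_int i \<le> u \<and> u \<le> real_of_int i + 1"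
proof (cases "u = real_of_int b")
  case True
  then show ?thesis using assms by (intro exI[of _ "b - 1"]) auto
next
  case False
  then have "u < real_of_int b" using assms by simp
  then have "\<lfloor>u\<rfloor> < b" by (simp add: floor_less_iff)
  then show ?thesis using assms by (intro exI[of _ "\<lfloor>u\<rfloor>"]) (auto simp: le_floor_iff)
qed

locale handle_grid =
  fixes h N :: nat
  assumes N_pos: "0 < N"

sublocale handle_grid \<subseteq> strip "width h N" "int N" "hole h N"
  by (rule strip_grid[OF N_pos])

context handle_grid
begin

lemma abscissa_bounds:
  assumes "p \<in> sphere_with_handles h"
  shows "0 \<le> real N * abscissa h p" "real N * abscissa h p \<le> real_of_int (width h N)"
proof -
  have "\<bar>Re (fst p)\<bar> \<le> 1" using surface_coordinates(4)[OF assms] .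
  then have "0 \<le> Re (fst p) + 1" "Re (fst p) + 1 \<le> 2" by auto
  then show "0 \<le> real N * abscissa h p" "real N * abscissa h p \<le> real_of_int (width h N)"
    unfolding abscissa_def width_def by (auto simp: mult_ac intro!: mult_left_mono)
qed

lemma gap_ge_abs_level:
  assumes "p \<in> sphere_with_handles h"
  shows "\<bar>level h p\<bar> \<le> gap h (Re (fst p))"
  using surface_coordinates(2)[OF assms] by (metis diff_ge_0_iff_ge zero_le_power2)

lemma pieces_cover:
  assumes p: "p \<in> sphere_with_handles h"
  shows "\<exists>f\<in>faces. p \<in> piece h N f"
proof -
  let ?x = "Re (fst p)" and ?u = "real N * abscissa h p"
  \<comment> \<open>At the right end of a hole, rounding down would give a column without a tab. On
    a tube the column is therefore sought within the hole.\<close>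
  have "\<exists>i. 0 \<le> i \<and> i < width h N \<and> (level h p < 0 \<longrightarrow> hole h N i) \<and> real_of_int i \<le> ?u \<and> ?u \<le> real_of_int i + 1"
  proof (cases "level h p < 0")
    case True
    then obtain q where q: "q < h" "\<bar>offset h q ?x\<bar> \<le> 1" using surface_coordinates(3)[OF p] by blast
    have "(4 * int q + 1) * int N < (4 * int q + 3) * int N" using N_pos by simp
    moreover have "real_of_int ((4 * int q + 1) * int N) \<le> ?u" "?u \<le> real_of_int ((4 * int q + 3) * int N)"
      using hole_offset(2)[OF N_pos q(1), of ?x] q(2) unfolding abscissa_def by blast+
    ultimately obtain i where i: "(4 * int q + 1) * int N \<le> i" "i < (4 * int q + 3) * int N"
      "real_of_int i \<le> ?u" "?u \<le> real_of_int i + 1"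
      using unit_interval_containing by blast
    then have "hole h N i" using q(1) unfolding hole_def by blast
    then show ?thesis using i hole_bounds[OF N_pos, of h i] by (intro exI[of _ i]) auto
  next
    case False
    then show ?thesis using unit_interval_containing[of 0 ?u "width h N"] abscissa_bounds[OF p] M by auto
  qed
  then obtain i where i: "0 \<le> i" "i < width h N" "level h p < 0 \<longrightarrow> hole h N i"
    "real_of_int i \<le> ?u" "?u \<le> real_of_int i + 1" by blast
  have "\<exists>j. cell i j \<and> real_of_int j * gap h ?x \<le> real N * level h p \<and>
      real N * level h p \<le> (real_of_int j + 1) * gap h ?x"
  proof (cases "gap h ?x = 0")
    case True
    then have "level h p = 0" using gap_ge_abs_level[OF p] by simp
    then show ?thesis using True i N by (intro exI[of _ 0]) (auto simp: cell_def)
  next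
    case False
    then have g: "0 < gap h ?x" using gap_ge_abs_level[OF p] by simp
    define v where "v = real N * level h p / gap h ?x"
    have "real N * \<bar>level h p\<bar> \<le> real N * gap h ?x"
      using gap_ge_abs_level[OF p] by (intro mult_left_mono) auto
    then have "\<bar>v\<bar> \<le> real N" unfolding v_def using g by (simp add: abs_mult pos_divide_le_eq)
    \<comment> \<open>Splitting the range at 0 keeps the point \<open>v = 0\<close> out of the
      negative rows, whose cells require a tab.\<close>
    then have "\<exists>j. (if v < 0 then - int N else 0) \<le> j \<and> j < (if v < 0 then 0 else int N) \<and>
        real_of_int j \<le> v \<and> v \<le> real_of_int j + 1"
      using N_pos by (intro unit_interval_containing) auto
    then obtain j where j: "(if v < 0 then - int N else 0) \<le> j" "j < (if v < 0 then 0 else int N)"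
      "real_of_int j \<le> v" "v \<le> real_of_int j + 1" by blast
    have "v < 0 \<Longrightarrow> level h p < 0" unfolding v_def using g N_pos
      by (simp add: divide_less_0_iff mult_less_0_iff)
    then have "cell i j" using i j N_pos unfolding cell_def by (auto split: if_splits)
    then show ?thesis using j(3,4) g unfolding v_def by (auto simp: field_simps)
  qed
  then obtain j where j: "cell i j" "real_of_int j * gap h ?x \<le> real N * level h p"
      "real N * level h p \<le> (real_of_int j + 1) * gap h ?x" by blast
  define s :: int where "s = (if 0 \<le> Im (fst p) then 1 else -1)"
  define t :: int where "t = (if 0 \<le> snd p then 1 else -1)"
  have "(i, j, s, t) \<in> faces" using j(1) unfolding faces_def s_def t_def by auto
  moreover have "p \<in> piece h N (i, j, s, t)"
    using p i j unfolding piece_def s_def t_def by auto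
  ultimately show ?thesis by blast
qed

text \<open>Rounding both coordinates down gives a grid vertex that is a corner of every cell
  containing the point. The signs of \<open>y\<close> and \<open>z\<close> select the copy, and are
  ambiguous only if \<open>y = 0\<close> or \<open>z = 0\<close>; the vertex then lies on the
  corresponding glued boundary, where the sign is normalised away.\<close>

lemma pieces_common_corner:
  assumes p: "p \<in> sphere_with_handles h" and x: "\<bar>Re (fst p)\<bar> < 1"
  shows "\<exists>k. \<forall>f\<in>faces. p \<in> piece h N f \<longrightarrow> k \<in> corners f"
proof -
  let ?x = "Re (fst p)" and ?u = "real N * abscissa h p"
  have g: "0 < gap h ?x" using gap_pos[OF x] .
  define v where "v = real N * level h p / gap h ?x"
  define i where "i = \<lfloor>?u\<rfloor>"
  define j where "j = \<lfloor>v\<rfloor>"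
  have y: "yside i j" if "Im (fst p) = 0"
  proof -
    have "chord h ?x + max 0 (level h p) = 0" using surface_coordinates(1)[OF p] that by simp
    then have c0: "chord h ?x = 0" "level h p \<le> 0" using chord_nonneg[of h ?x] by linarith+
    then have "v \<le> 0" unfolding v_def using g by (simp add: divide_le_0_iff mult_nonneg_nonpos)
    then have "j \<le> 0" unfolding j_def by (simp add: floor_le_iff)
    moreover have "\<not> (hole h N (i - 1) \<and> hole h N i)"
    proof
      assume "hole h N (i - 1) \<and> hole h N i"
      then obtain q where q: "q < h" "(4 * int q + 1) * int N < i" "i < (4 * int q + 3) * int N"
        unfolding inner_hole_iff[OF N_pos] by blast
      have "real_of_int ((4 * int q + 1) * int N) < ?u" "?u < real_of_int ((4 * int q + 3) * int N)"
        using q(2,3) unfolding i_def by linarith+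
      then have "\<bar>offset h q ?x\<bar> < 1" using hole_offset(1)[OF N_pos q(1), of ?x] unfolding abscissa_def by blast
      then show False using chord_pos[OF q(1)] c0 by fastforce
    qed
    ultimately show ?thesis unfolding yside_def by blast
  qed
  have z: "zside i j" if "snd p = 0"
  proof -
    have "\<bar>level h p\<bar> = gap h ?x" using surface_coordinates(2)[OF p] that by simp
    then have "level h p = gap h ?x \<or> level h p = - gap h ?x" by linarith
    then have "v = real N \<or> v = - real N" using g unfolding v_def by auto
    then have "j = int N \<or> j = - int N" unfolding j_def by (auto simp: floor_eq_iff)
    then show ?thesis unfolding zside_def by blast
  qed
  define s :: int where "s = (if 0 \<le> Im (fst p) then 1 else -1)"
  define t :: int where "t = (if 0 \<le> snd p then 1 else -1)"
  have "vert i j s t \<in> corners f" if f: "f \<in> faces" "p \<in> piece h N f" for f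
  proof -
    obtain i' j' s' t' where f': "f = (i', j', s', t')" by (cases f)
    have st: "s' \<in> {-1, 1}" "t' \<in> {-1, 1}" using f(1) unfolding f' faces_def by auto
    have q: "real_of_int i' \<le> ?u" "?u \<le> real_of_int i' + 1"
      "real_of_int j' * gap h ?x \<le> real N * level h p" "real N * level h p \<le> (real_of_int j' + 1) * gap h ?x"
      "0 \<le> real_of_int s' * Im (fst p)" "0 \<le> real_of_int t' * snd p"
      using f(2) unfolding f' piece_def by auto
    have "real_of_int j' \<le> v" "v \<le> real_of_int j' + 1" using q(3,4) g unfolding v_def by (auto simp: field_simps)
    then have "j = j' \<or> j = j' + 1" unfolding j_def by linarith
    moreover have "i = i' \<or> i = i' + 1" using q(1,2) unfolding i_def by linarith
    moreover have "s = s' \<or> yside i j" using y q(5) st(1) unfolding s_def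
      by (cases "Im (fst p) = 0") (auto simp: zero_le_mult_iff)
    moreover have "t = t' \<or> zside i j" using z q(6) st(2) unfolding t_def
      by (cases "snd p = 0") (auto simp: zero_le_mult_iff)
    ultimately show ?thesis unfolding f' by (auto simp: vert_def)
  qed
  then show ?thesis by blast
qed

lemma pieces_at_pole:
  assumes p: "p \<in> sphere_with_handles h" and x: "\<bar>Re (fst p)\<bar> = 1"
  shows "\<exists>i. (i = 0 \<or> i = width h N - 1) \<and> {f \<in> faces. p \<in> piece h N f} = {f \<in> faces. fst f = i}"
proof -
  let ?x = "Re (fst p)"
  have "?x\<^sup>2 = 1" using x by (metis power2_abs one_power2)
  then have "gap h ?x = - chord h ?x" unfolding gap_def by simp
  then have g: "chord h ?x = 0" "gap h ?x = 0" "level h p = 0"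
    using gap_ge_abs_level[OF p] chord_nonneg[of h ?x] by linarith+
  have yz: "Im (fst p) = 0" "snd p = 0" using surface_coordinates(1,2)[OF p] g by auto
  define i where "i = (if ?x = 1 then width h N - 1 else 0)"
  have "?x = 1 \<or> ?x = -1" using x by linarith
  then have u: "real N * abscissa h p = (if ?x = 1 then real_of_int (width h N) else 0)"
    unfolding abscissa_def width_def by auto
  have "p \<in> piece h N f \<longleftrightarrow> fst f = i" if "f \<in> faces" for f
  proof -
    obtain i' j' s' t' where f': "f = (i', j', s', t')" by (cases f)
    have "0 \<le> i'" "i' < width h N" using that unfolding f' faces_def cell_def by auto
    moreover have "p \<in> piece h N f \<longleftrightarrow> real_of_int i' \<le> real N * abscissa h p \<and> real N * abscissa h p \<le> real_of_int i' + 1"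
      unfolding f' piece_def using p g yz by simp
    ultimately show ?thesis unfolding u f' i_def using M by auto
  qed
  then show ?thesis unfolding i_def by (intro exI[of _ i]) (auto simp: i_def)
qed

text \<open>The local step of \<open>trace_linked\<close>: it leads from one piece to another
  through a common point.\<close>

lemma corners_at_point_linked:
  assumes p: "p \<in> sphere_with_handles h"
  shows "linked_within src tgt edges (\<Union>f\<in>{f \<in> faces. p \<in> piece h N f}. corners f)"
proof (cases "\<bar>Re (fst p)\<bar> = 1")
  case True
  then obtain i where "i = 0 \<or> i = width h N - 1"
    and eq: "{f \<in> faces. p \<in> piece h N f} = {f \<in> faces. fst f = i}"
    using pieces_at_pole[OF p] by blast
  then show ?thesis unfolding eq by (intro end_column_linked)
next
  case False
  then have "\<bar>Re (fst p)\<bar> < 1" using surface_coordinates(4)[OF p] by simp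
  then obtain k where k: "\<And>f. f \<in> faces \<Longrightarrow> p \<in> piece h N f \<Longrightarrow> k \<in> corners f"
    using pieces_common_corner[OF p] by blast
  show ?thesis
  proof (rule linked_withinI_root)
    fix x assume "x \<in> (\<Union>f\<in>{f \<in> faces. p \<in> piece h N f}. corners f)"
    then obtain f where f: "f \<in> faces" "p \<in> piece h N f" "x \<in> corners f" by blast
    then show "(k, x) \<in> linked src tgt {e \<in> edges.
       src e \<in> (\<Union>f\<in>{f \<in> faces. p \<in> piece h N f}. corners f) \<and>
       tgt e \<in> (\<Union>f\<in>{f \<in> faces. p \<in> piece h N f}. corners f)}"
      using k by (intro corners_linked[of f]) blast+
  qed
qed


text \<open>The common corner, rescaled, is the required pair. A nonzero sign at this corner is
  shared by both faces, so the coordinates of the points do not have opposite signs; a sign 0 places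
  the corner on a glued boundary, which the alternatives describe in terms of the rescaled
  pair.\<close>

lemma shared_corner_estimate:
  assumes f: "f \<in> faces" "p \<in> piece h N f" and g: "g \<in> faces" "q \<in> piece h N g"
    and k: "corners f \<inter> corners g \<noteq> {}"
  shows "\<exists>\<alpha> \<tau>. \<alpha> \<in> {0..2 * real (hscale h)} \<and> \<tau> \<in> {-1..1} \<and> grid_near h N \<alpha> \<tau> p \<and> grid_near h N \<alpha> \<tau> q \<and>
    (0 \<le> Im (fst p) * Im (fst q) \<or> \<tau> \<le> 0 \<and> chord h (\<alpha> / real (hscale h) - 1) = 0) \<and>
    (0 \<le> snd p * snd q \<or> \<bar>\<tau>\<bar> = 1 \<or> \<alpha> = 0 \<or> \<alpha> = 2 * real (hscale h))"
proof -
  let ?L = "real (hscale h)"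
  have L: "0 < ?L" using hscale_pos by simp
  have N': "0 < real N" using N_pos by simp
  obtain i\<^sub>1 j\<^sub>1 s\<^sub>1 t\<^sub>1 where f': "f = (i\<^sub>1, j\<^sub>1, s\<^sub>1, t\<^sub>1)" by (cases f)
  obtain i\<^sub>2 j\<^sub>2 s\<^sub>2 t\<^sub>2 where g': "g = (i\<^sub>2, j\<^sub>2, s\<^sub>2, t\<^sub>2)" by (cases g)
  obtain i j \<sigma> \<rho> where c1: "(i, j, \<sigma>, \<rho>) \<in> corners f" and c2: "(i, j, \<sigma>, \<rho>) \<in> corners g"
    using k by auto
  have k1: "i = i\<^sub>1 \<or> i = i\<^sub>1 + 1" "j = j\<^sub>1 \<or> j = j\<^sub>1 + 1"
      "\<sigma> = (if yside i j then 0 else s\<^sub>1)" "\<rho> = (if zside i j then 0 else t\<^sub>1)"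
    using c1 unfolding f' by (auto simp: vert_def)
  have k2: "i = i\<^sub>2 \<or> i = i\<^sub>2 + 1" "j = j\<^sub>2 \<or> j = j\<^sub>2 + 1"
      "\<sigma> = (if yside i j then 0 else s\<^sub>2)" "\<rho> = (if zside i j then 0 else t\<^sub>2)"
    using c2 unfolding g' by (auto simp: vert_def)
  have st: "s\<^sub>1 \<in> {-1, 1}" "t\<^sub>1 \<in> {-1, 1}" and cell: "cell i\<^sub>1 j\<^sub>1" using f(1) unfolding f' faces_def by auto
  define \<alpha> where "\<alpha> = real_of_int i / real N"
  define \<tau> where "\<tau> = real_of_int j / real N"
  have near: "grid_near h N \<alpha> \<tau> x"
    if x: "x \<in> piece h N (i', j', s', t')" and i': "i = i' \<or> i = i' + 1" and j': "j = j' \<or> j = j' + 1"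
    for x i' j' s' t'
  proof -
    have S: "x \<in> sphere_with_handles h" and c: "real_of_int i' \<le> real N * abscissa h x" "real N * abscissa h x \<le> real_of_int i' + 1"
      "real_of_int j' * gap h (Re (fst x)) \<le> real N * level h x"
      "real N * level h x \<le> (real_of_int j' + 1) * gap h (Re (fst x))"
      using x unfolding piece_def by auto
    have "\<bar>real N * abscissa h x - real_of_int i\<bar> \<le> 1" using c(1,2) i' by auto
    then have "\<bar>real N * (abscissa h x - \<alpha>)\<bar> \<le> 1" unfolding \<alpha>_def using N' by (simp add: right_diff_distrib)
    then have 1: "\<bar>abscissa h x - \<alpha>\<bar> \<le> 1 / real N"
      by (simp add: abs_mult pos_le_divide_eq[OF N'] mult.commute)
    have "0 \<le> gap h (Re (fst x))" using gap_ge_abs_level[OF S] by simp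
    then have "\<bar>real N * level h x - real_of_int j * gap h (Re (fst x))\<bar> \<le> gap h (Re (fst x))"
      using c(3,4) j' by (auto simp: algebra_simps)
    then have "\<bar>real N * (level h x - \<tau> * gap h (Re (fst x)))\<bar> \<le> gap h (Re (fst x))"
      unfolding \<tau>_def using N' by (simp add: right_diff_distrib)
    then have "\<bar>level h x - \<tau> * gap h (Re (fst x))\<bar> \<le> gap h (Re (fst x)) / real N"
      by (simp add: abs_mult pos_le_divide_eq[OF N'] mult.commute)
    then show ?thesis using 1 S unfolding grid_near_def by blast
  qed
  have ij: "0 \<le> i" "i \<le> width h N" "- int N \<le> j" "j \<le> int N" using cell k1 unfolding cell_def by auto
  have w: "real_of_int (width h N) = real N * (2 * ?L)" unfolding width_def by simp
  have "real_of_int i \<le> real N * (2 * ?L)" using ij(2) unfolding w[symmetric] by simp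
  then have "0 \<le> \<alpha>" "\<alpha> \<le> 2 * ?L" "-1 \<le> \<tau>" "\<tau> \<le> 1"
    using N' ij unfolding \<alpha>_def \<tau>_def by (auto simp: field_simps)
  moreover have "grid_near h N \<alpha> \<tau> p" "grid_near h N \<alpha> \<tau> q"
    using near f(2) g(2) k1(1,2) k2(1,2) unfolding f' g' by blast+
  moreover have "0 \<le> Im (fst p) * Im (fst q) \<or> \<tau> \<le> 0 \<and> chord h (\<alpha> / ?L - 1) = 0"
  proof (cases "yside i j")
    case True
    have "chord h (\<alpha> / ?L - 1) = 0"
    proof (rule chord_eq_0, rule ccontr)
      fix m assume m: "m < h" "\<not> 1 \<le> \<bar>offset h m (\<alpha> / ?L - 1)\<bar>"
      have "real N * (?L * (\<alpha> / ?L - 1 + 1)) = real_of_int i" unfolding \<alpha>_def using N' L by simp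
      then have "real_of_int ((4 * int m + 1) * int N) < real_of_int i" "real_of_int i < real_of_int ((4 * int m + 3) * int N)"
        using hole_offset(1)[OF N_pos m(1), of "\<alpha> / ?L - 1"] m(2) by auto
      then have "hole h N (i - 1) \<and> hole h N i"
        unfolding inner_hole_iff[OF N_pos] of_int_less_iff using m(1) by blast
      then show False using True unfolding yside_def by blast
    qed
    moreover have "\<tau> \<le> 0" using True N' unfolding yside_def \<tau>_def by (simp add: divide_le_0_iff)
    ultimately show ?thesis by blast
  next
    case False
    then have "s\<^sub>1 = s\<^sub>2" using k1 k2 by simp
    then have "0 \<le> real_of_int s\<^sub>1 * Im (fst p)" "0 \<le> real_of_int s\<^sub>1 * Im (fst q)"
      using f(2) g(2) unfolding f' g' piece_def by auto
    then show ?thesis using st by (auto simp: zero_le_mult_iff)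
  qed
  moreover have "0 \<le> snd p * snd q \<or> \<bar>\<tau>\<bar> = 1 \<or> \<alpha> = 0 \<or> \<alpha> = 2 * ?L"
  proof (cases "zside i j")
    case True
    then show ?thesis using N' w unfolding zside_def \<tau>_def \<alpha>_def by auto
  next
    case False
    then have "t\<^sub>1 = t\<^sub>2" using k1 k2 by simp
    then have "0 \<le> real_of_int t\<^sub>1 * snd p" "0 \<le> real_of_int t\<^sub>1 * snd q"
      using f(2) g(2) unfolding f' g' piece_def by auto
    then show ?thesis using st by (auto simp: zero_le_mult_iff)
  qed
  ultimately show ?thesis by (intro exI[of _ \<alpha>] exI[of _ \<tau>]) simp
qed

end

section \<open>The mesh of the quadrangulations tends to zero\<close>

lemma limit_zero_of_bound:
  fixes f g :: "nat \<Rightarrow> real"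
  assumes "f \<longlonglongrightarrow> l" "g \<longlonglongrightarrow> 0" "\<And>n. \<bar>f n\<bar> \<le> g n"
  shows "l = 0"
proof -
  have "f \<longlonglongrightarrow> 0" using assms(2,3) by (intro Lim_null_comparison[of f g]) auto
  then show ?thesis using assms(1) LIMSEQ_unique by blast
qed

text \<open>An explicit modulus is awkward, since \<open>y\<close> and \<open>z\<close> are square
  roots in the coordinates and the rows collapse at the poles. Compactness replaces it: limits of
  counterexamples agree in \<open>x\<close> and \<open>level\<close>, hence in the squares of
  \<open>y\<close> and \<open>z\<close>, and it remains to exclude opposite signs.\<close>

lemma shared_corner_dist:
  assumes "0 < \<epsilon>"
  shows "\<exists>n. \<forall>N\<ge>n. \<forall>f g p q. 0 < N \<and> f \<in> strip.faces (width h N) (int N) (hole h N) \<and>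
    g \<in> strip.faces (width h N) (int N) (hole h N) \<and> p \<in> piece h N f \<and> q \<in> piece h N g \<and>
    strip.corners (width h N) (int N) (hole h N) f \<inter> strip.corners (width h N) (int N) (hole h N) g \<noteq> {}
    \<longrightarrow> dist p q < \<epsilon>"
proof (rule ccontr)
  assume contra: "\<not> ?thesis"
  let ?L = "real (hscale h)" and ?S = "sphere_with_handles h"
  let ?P = "\<lambda>n N p q \<alpha> \<tau>. n \<le> N \<and> 0 < N \<and> \<epsilon> \<le> dist p q \<and> \<alpha> \<in> {0..2 * ?L} \<and> \<tau> \<in> {-1..1} \<and>
    grid_near h N \<alpha> \<tau> p \<and> grid_near h N \<alpha> \<tau> q \<and>
    (0 \<le> Im (fst p) * Im (fst q) \<or> \<tau> \<le> 0 \<and> chord h (\<alpha> / ?L - 1) = 0) \<and>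
    (0 \<le> snd p * snd q \<or> \<bar>\<tau>\<bar> = 1 \<or> \<alpha> = 0 \<or> \<alpha> = 2 * ?L)"
  have L: "0 < ?L" using hscale_pos by simp
  have ex: "\<exists>N p q \<alpha> \<tau>. ?P n N p q \<alpha> \<tau>" for n
  proof -
    obtain N f g p q where *: "n \<le> N" "0 < N" "f \<in> strip.faces (width h N) (int N) (hole h N)"
      "g \<in> strip.faces (width h N) (int N) (hole h N)" "p \<in> piece h N f" "q \<in> piece h N g"
      "strip.corners (width h N) (int N) (hole h N) f \<inter> strip.corners (width h N) (int N) (hole h N) g \<noteq> {}"
      "\<epsilon> \<le> dist p q"
      using contra by (meson not_le)
    interpret handle_grid h N by unfold_locales (rule *(2))
    show ?thesis using shared_corner_estimate[OF *(3,5,4,6,7)] *(1,2,8) by blast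
  qed
  obtain N p q \<alpha> \<tau> where P: "\<And>n. ?P n (N n) (p n) (q n) (\<alpha> n) (\<tau> n)"
    using ex by metis
  define X where "X n = (p n, q n, \<alpha> n, \<tau> n)" for n
  have "compact (?S \<times> ?S \<times> {0..2 * ?L} \<times> {-1..1 :: real})"
    by (intro compact_Times compact_sphere_with_handles compact_Icc)
  moreover have "\<forall>n. X n \<in> ?S \<times> ?S \<times> {0..2 * ?L} \<times> {-1..1}"
    using P unfolding X_def grid_near_def by auto
  ultimately obtain Y r where Y: "Y \<in> ?S \<times> ?S \<times> {0..2 * ?L} \<times> {-1..1}" "strict_mono r" "(X \<circ> r) \<longlonglongrightarrow> Y"
    unfolding compact_def by meson
  obtain p' q' \<alpha>' \<tau>' where Y': "Y = (p', q', \<alpha>', \<tau>')" by (cases Y)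
  have S: "p' \<in> ?S" "q' \<in> ?S" using Y(1) unfolding Y' by auto
  have lims: "(\<lambda>n. p (r n)) \<longlonglongrightarrow> p'" "(\<lambda>n. q (r n)) \<longlonglongrightarrow> q'" "(\<lambda>n. \<alpha> (r n)) \<longlonglongrightarrow> \<alpha>'" "(\<lambda>n. \<tau> (r n)) \<longlonglongrightarrow> \<tau>'"
    using tendsto_fst[OF Y(3)] tendsto_fst[OF tendsto_snd[OF Y(3)]]
      tendsto_fst[OF tendsto_snd[OF tendsto_snd[OF Y(3)]]] tendsto_snd[OF tendsto_snd[OF tendsto_snd[OF Y(3)]]]
    unfolding Y' X_def comp_def by simp_all
  have N0: "(\<lambda>n. 1 / real (N (r n))) \<longlonglongrightarrow> 0"
  proof (rule Lim_null_comparison[OF _ lim_1_over_n])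
    have "n \<le> N (r n)" "0 < N (r n)" for n using P[of "r n"] seq_suble[OF Y(2), of n] by linarith+
    then show "\<forall>\<^sub>F n in sequentially. norm (1 / real (N (r n))) \<le> 1 / real n"
      unfolding eventually_sequentially by (intro exI[of _ 1]) (auto intro!: divide_left_mono mult_pos_pos)
  qed
  have limit: "abscissa h x' = \<alpha>'" "level h x' = \<tau>' * gap h (Re (fst x'))"
    if x: "x \<longlonglongrightarrow> x'" and near: "\<And>n. grid_near h (N (r n)) (\<alpha> (r n)) (\<tau> (r n)) (x n)" for x x'
  proof -
    have "(\<lambda>n. abscissa h (x n) - \<alpha> (r n)) \<longlonglongrightarrow> abscissa h x' - \<alpha>'"
      unfolding abscissa_def by (intro tendsto_intros x lims)
    then have "abscissa h x' - \<alpha>' = 0"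
      by (rule limit_zero_of_bound[OF _ N0]) (use near in \<open>auto simp: grid_near_def\<close>)
    then show "abscissa h x' = \<alpha>'" by simp
    have g: "(\<lambda>n. gap h (Re (fst (x n)))) \<longlonglongrightarrow> gap h (Re (fst x'))"
      using continuous_on_tendsto_compose[OF continuous_on_gap_Re x] by simp
    have "(\<lambda>n. level h (x n) - \<tau> (r n) * gap h (Re (fst (x n)))) \<longlonglongrightarrow> level h x' - \<tau>' * gap h (Re (fst x'))"
      using continuous_on_tendsto_compose[OF continuous_on_level x] by (intro tendsto_intros g lims) simp
    moreover have "(\<lambda>n. gap h (Re (fst (x n))) / real (N (r n))) \<longlonglongrightarrow> 0"
      using tendsto_mult[OF g N0] by simp
    ultimately have "level h x' - \<tau>' * gap h (Re (fst x')) = 0"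
      by (rule limit_zero_of_bound) (use near in \<open>auto simp: grid_near_def\<close>)
    then show "level h x' = \<tau>' * gap h (Re (fst x'))" by simp
  qed
  have lp: "abscissa h p' = \<alpha>'" "level h p' = \<tau>' * gap h (Re (fst p'))"
    using limit[OF lims(1)] P by blast+
  have lq: "abscissa h q' = \<alpha>'" "level h q' = \<tau>' * gap h (Re (fst q'))"
    using limit[OF lims(2)] P by blast+
  have xa: "Re (fst p') = \<alpha>' / ?L - 1" using lp(1) L unfolding abscissa_def by (simp add: field_simps)
  moreover have "Re (fst q') = \<alpha>' / ?L - 1" using lq(1) L unfolding abscissa_def by (simp add: field_simps)
  ultimately have x: "Re (fst p') = Re (fst q')" by simp
  have lev: "level h p' = level h q'" using lp lq x by simp
  have y2: "(Im (fst p'))\<^sup>2 = (Im (fst q'))\<^sup>2" and z2: "(snd p')\<^sup>2 = (snd q')\<^sup>2"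
    using surface_coordinates(1,2)[OF S(1)] surface_coordinates(1,2)[OF S(2)] x lev by simp_all
  have gap0: "0 \<le> gap h (Re (fst p'))" using surface_coordinates(2)[OF S(1)] by (smt (verit) zero_le_power2)
  \<comment> \<open>Opposite nonzero limits make the products eventually negative, so the other
    alternative holds eventually. In the limit \<open>chord\<close> vanishes and
    \<open>level\<close> is at most 0, which forces \<open>y = 0\<close>.\<close>
  have y: "Im (fst p') = Im (fst q')"
  proof (rule ccontr)
    assume ne: "Im (fst p') \<noteq> Im (fst q')"
    then have op: "Im (fst q') = - Im (fst p')" "Im (fst p') \<noteq> 0" using y2 by (auto simp: power2_eq_iff)
    then have "Im (fst p') * Im (fst q') < 0" by (auto simp: zero_less_mult_iff)
    moreover have "(\<lambda>n. Im (fst (p (r n))) * Im (fst (q (r n)))) \<longlonglongrightarrow> Im (fst p') * Im (fst q')"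
      by (intro tendsto_intros lims)
    ultimately have "\<forall>\<^sub>F n in sequentially. Im (fst (p (r n))) * Im (fst (q (r n))) < 0"
      by (rule order_tendstoD(2)[rotated])
    then have ev: "\<forall>\<^sub>F n in sequentially. \<tau> (r n) \<le> 0 \<and> chord h (\<alpha> (r n) / ?L - 1) = 0"
      by eventually_elim (use P in \<open>smt (verit)\<close>)
    then have "\<tau>' \<le> 0"
      by (intro tendsto_upperbound[OF lims(4)]) (auto elim: eventually_mono)
    then have "level h p' \<le> 0" unfolding lp(2) using gap0 by (simp add: mult_nonpos_nonneg)
    moreover have "chord h (Re (fst p')) = 0"
    proof -
      have "(\<lambda>n. \<alpha> (r n) / ?L - 1) \<longlonglongrightarrow> Re (fst p')"
        unfolding xa using L by (intro tendsto_intros lims) simp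
      then have "(\<lambda>n. chord h (\<alpha> (r n) / ?L - 1)) \<longlonglongrightarrow> chord h (Re (fst p'))"
        using continuous_on_tendsto_compose[OF continuous_on_chord] by simp
      moreover have "(\<lambda>n. chord h (\<alpha> (r n) / ?L - 1)) \<longlonglongrightarrow> 0"
        by (rule tendsto_eventually) (use ev in \<open>auto elim: eventually_mono\<close>)
      ultimately show ?thesis by (rule LIMSEQ_unique)
    qed
    ultimately show False using surface_coordinates(1)[OF S(1)] op(2) by simp
  qed
  have z: "snd p' = snd q'"
  proof (rule ccontr)
    assume ne: "snd p' \<noteq> snd q'"
    then have op: "snd q' = - snd p'" "snd p' \<noteq> 0" using z2 by (auto simp: power2_eq_iff)
    then have "snd p' * snd q' < 0" by (auto simp: zero_less_mult_iff)
    moreover have "(\<lambda>n. snd (p (r n)) * snd (q (r n))) \<longlonglongrightarrow> snd p' * snd q'"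
      by (intro tendsto_intros lims)
    ultimately have "\<forall>\<^sub>F n in sequentially. snd (p (r n)) * snd (q (r n)) < 0"
      by (rule order_tendstoD(2)[rotated])
    \<comment> \<open>The three alternatives become one vanishing product, a condition that passes
      to the limit.\<close>
    then have "\<forall>\<^sub>F n in sequentially. (1 - \<bar>\<tau> (r n)\<bar>) * \<alpha> (r n) * (2 * ?L - \<alpha> (r n)) = 0"
      by eventually_elim (use P in \<open>smt (verit) mult_eq_0_iff\<close>)
    then have "(\<lambda>n. (1 - \<bar>\<tau> (r n)\<bar>) * \<alpha> (r n) * (2 * ?L - \<alpha> (r n))) \<longlonglongrightarrow> 0"
      by (rule tendsto_eventually)
    moreover have "(\<lambda>n. (1 - \<bar>\<tau> (r n)\<bar>) * \<alpha> (r n) * (2 * ?L - \<alpha> (r n))) \<longlonglongrightarrow> (1 - \<bar>\<tau>'\<bar>) * \<alpha>' * (2 * ?L - \<alpha>')"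
      by (intro tendsto_intros lims)
    ultimately have "(1 - \<bar>\<tau>'\<bar>) * \<alpha>' * (2 * ?L - \<alpha>') = 0" using LIMSEQ_unique by blast
    then consider "\<bar>\<tau>'\<bar> = 1" | "\<alpha>' = 0 \<or> \<alpha>' = 2 * ?L" by auto
    then have "gap h (Re (fst p')) \<le> \<bar>level h p'\<bar>"
    proof cases
      case 1
      then show ?thesis unfolding lp(2) abs_mult by simp
    next
      case 2
      then have "(Re (fst p'))\<^sup>2 = 1" unfolding xa using L by auto
      then show ?thesis using chord_nonneg[of h "Re (fst p')"] unfolding gap_def by simp
    qed
    then have "(snd p')\<^sup>2 \<le> 0" using surface_coordinates(2)[OF S(1)] by simp
    then show False using op(2) by simp
  qed
  have "p' = q'" using x y z by (simp add: prod_eq_iff complex_eq_iff)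
  moreover have "(\<lambda>n. dist (p (r n)) (q (r n))) \<longlonglongrightarrow> dist p' q'" by (intro tendsto_intros lims)
  then have "\<epsilon> \<le> dist p' q'" by (rule tendsto_lowerbound) (use P in auto)
  ultimately show False using assms by simp
qed

section \<open>Embedded graphs\<close>

context handle_grid
begin

text \<open>All corners of the pieces that are met: two traces intersect only if faces meeting the
  two sets share a corner, which \<open>shared_corner_dist\<close> controls.\<close>

definition trace :: "(complex \<times> real) set \<Rightarrow> quad set" where
  "trace X = (\<Union>f\<in>{f \<in> faces. piece h N f \<inter> X \<noteq> {}}. corners f)"

lemma trace_subset_nodes: "trace X \<subseteq> nodes"
  unfolding trace_def nodes_def by blast

lemma corners_nonempty: "corners f \<noteq> {}"
  by (cases f) simp

lemma trace_Int_nonempty: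
  assumes "X \<inter> Y \<noteq> {}" "X \<subseteq> sphere_with_handles h"
  shows "trace X \<inter> trace Y \<noteq> {}"
proof -
  obtain p where p: "p \<in> X" "p \<in> Y" using assms(1) by blast
  then obtain f where f: "f \<in> faces" "p \<in> piece h N f" using pieces_cover assms(2) by blast
  have "corners f \<subseteq> trace X" "corners f \<subseteq> trace Y"
    using f p unfolding trace_def by blast+
  then show ?thesis using corners_nonempty[of f] by blast
qed

text \<open>The pieces meeting \<open>X\<close> are divided into those with corners reachable from
  \<open>r\<close> and the rest. Both unions are closed, and no point of \<open>X\<close> is in both
  by \<open>corners_at_point_linked\<close>, so connectedness leaves the second family
  empty.\<close>

lemma trace_linked:
  assumes conn: "Topological_Spaces.connected X" and X: "X \<subseteq> sphere_with_handles h"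
  shows "linked_within src tgt edges (trace X)"
proof -
  let ?L = "linked src tgt {e \<in> edges. src e \<in> trace X \<and> tgt e \<in> trace X}"
  have "(r, y) \<in> ?L" if r: "r \<in> trace X" and y: "y \<in> trace X" for r y
  proof -
    define F where "F = {f \<in> faces. piece h N f \<inter> X \<noteq> {}}"
    define A where "A = {f \<in> F. \<forall>z\<in>corners f. (r, z) \<in> ?L}"
    let ?P = "\<lambda>F. \<Union>f\<in>F. piece h N f"
    have fin: "finite F" using finite_faces unfolding F_def by auto
    have sub: "corners f \<subseteq> trace X" if "f \<in> F" for f using that unfolding F_def trace_def by blast
    have good: "f \<in> A" if f: "f \<in> F" "x \<in> corners f" "(r, x) \<in> ?L" for f x
    proof -
      have "(x, z) \<in> ?L" if "z \<in> corners f" for z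
        using corners_linked[OF _ sub[OF f(1)] f(2) that] f(1) unfolding F_def by blast
      then show ?thesis using f linked_trans[OF f(3)] unfolding A_def by blast
    qed
    have "closed (?P A)" "closed (?P (F - A))"
      using fin closed_piece unfolding A_def by (intro closed_UN; auto)+
    moreover have "X \<subseteq> ?P A \<union> ?P (F - A)"
    proof
      fix x assume x: "x \<in> X"
      then obtain f where "f \<in> faces" "x \<in> piece h N f" using pieces_cover X by blast
      then have "f \<in> F" "x \<in> piece h N f" using x unfolding F_def by blast+
      then show "x \<in> ?P A \<union> ?P (F - A)" by blast
    qed
    moreover have "?P A \<inter> ?P (F - A) \<inter> X = {}"
    proof (rule ccontr)
      assume "\<not> ?thesis"
      then obtain p f g where p: "p \<in> X" "f \<in> A" "g \<in> F" "g \<notin> A" "p \<in> piece h N f" "p \<in> piece h N g"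
        by blast
      let ?W = "\<Union>f\<in>{f \<in> faces. p \<in> piece h N f}. corners f"
      have fF: "f \<in> F" using p(2) unfolding A_def by blast
      obtain x z where xz: "x \<in> corners f" "z \<in> corners g" using corners_nonempty by blast
      have "x \<in> ?W" "z \<in> ?W" using xz p fF unfolding F_def by blast+
      moreover have "?W \<subseteq> trace X" using p(1) unfolding trace_def by blast
      ultimately have xzL: "(x, z) \<in> ?L"
        using linked_within_subset[OF corners_at_point_linked[of p]] p(1) X by blast
      have "(r, x) \<in> ?L" using p(2) xz(1) unfolding A_def by blast
      from this xzL have "(r, z) \<in> ?L" by (rule linked_trans)
      then show False using good[OF p(3) xz(2)] p(4) by blast
    qed
    moreover have "?P A \<inter> X \<noteq> {}"
    proof -
      obtain f where f: "f \<in> F" "r \<in> corners f" using r unfolding trace_def F_def by blast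
      then have "f \<in> A" using good by blast
      then show ?thesis unfolding A_def F_def by blast
    qed
    ultimately have "?P (F - A) \<inter> X = {}"
      using conn[unfolded connected_closed] by (metis (no_types, lifting))
    moreover have "piece h N f \<inter> X \<noteq> {}" if "f \<in> F" for f using that unfolding F_def by simp
    ultimately have "F \<subseteq> A" by fast
    then show ?thesis using y unfolding A_def F_def trace_def by blast
  qed
  then show ?thesis unfolding linked_within_def by blast
qed

end

lemma trace_disjoint:
  assumes "compact X" "compact Y" "X \<inter> Y = {}"
  shows "\<forall>\<^sub>F N in sequentially. 0 < N \<and> handle_grid.trace h N X \<inter> handle_grid.trace h N Y = {}"
proof -
  obtain \<epsilon> where \<epsilon>: "0 < \<epsilon>" "\<And>x y. x \<in> X \<Longrightarrow> y \<in> Y \<Longrightarrow> \<epsilon> \<le> dist x y"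
    using separate_compact_closed[OF assms(1) compact_imp_closed[OF assms(2)] assms(3)] by blast
  obtain n where n: "\<And>N f g p q. n \<le> N \<Longrightarrow> 0 < N \<and> f \<in> strip.faces (width h N) (int N) (hole h N) \<and>
    g \<in> strip.faces (width h N) (int N) (hole h N) \<and> p \<in> piece h N f \<and> q \<in> piece h N g \<and>
    strip.corners (width h N) (int N) (hole h N) f \<inter> strip.corners (width h N) (int N) (hole h N) g \<noteq> {}
    \<longrightarrow> dist p q < \<epsilon>"
    using shared_corner_dist[OF \<epsilon>(1), of h] by blast
  have "0 < N \<and> handle_grid.trace h N X \<inter> handle_grid.trace h N Y = {}" if nN: "max 1 n \<le> N" for N
  proof -
    interpret handle_grid h N using nN by unfold_locales simp
    have "trace X \<inter> trace Y = {}"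
    proof (rule ccontr)
      assume "\<not> ?thesis"
      then obtain f g p q where "f \<in> faces" "p \<in> piece h N f" "p \<in> X" "g \<in> faces" "q \<in> piece h N g" "q \<in> Y"
        "corners f \<inter> corners g \<noteq> {}" unfolding trace_def by blast
      moreover have "n \<le> N" using nN by simp
      ultimately show False using n[of N f g p q] \<epsilon>(2)[of p q] N_pos by fastforce
    qed
    then show ?thesis using N_pos by blast
  qed
  then show ?thesis unfolding eventually_sequentially by blast
qed

text \<open>Only finitely many pairs of sets have to be separated, so one \<open>N\<close> works for
  all of them. The traces then have the incidence pattern of the sets themselves, and
  \<open>subdivision_labelling\<close> yields the minor.\<close>

lemma subdivision_in_surface_edge_bound:
  fixes X :: "'w \<Rightarrow> (complex \<times> real) set" and Y :: "'w set \<Rightarrow> (complex \<times> real) set"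
  assumes fin: "finite U" "finite H" and U: "U \<noteq> {}" and two: "2 \<le> card H"
    and H: "\<And>k. k \<in> H \<Longrightarrow> \<exists>u v. u \<noteq> v \<and> k = {u, v} \<and> u \<in> U \<and> v \<in> U"
    and X: "\<And>u. u \<in> U \<Longrightarrow> compact (X u) \<and> Topological_Spaces.connected (X u) \<and> X u \<noteq> {} \<and> X u \<subseteq> sphere_with_handles h"
    and Y: "\<And>k. k \<in> H \<Longrightarrow> compact (Y k) \<and> Topological_Spaces.connected (Y k) \<and> Y k \<subseteq> sphere_with_handles h"
    and XX: "\<And>u v. u \<in> U \<Longrightarrow> v \<in> U \<Longrightarrow> u \<noteq> v \<Longrightarrow> X u \<inter> X v = {}"
    and YY: "\<And>k l. k \<in> H \<Longrightarrow> l \<in> H \<Longrightarrow> k \<noteq> l \<Longrightarrow> Y k \<inter> Y l = {}"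
    and XY: "\<And>u k. u \<in> U \<Longrightarrow> k \<in> H \<Longrightarrow> X u \<inter> Y k \<noteq> {} \<longleftrightarrow> u \<in> k"
  shows "card H + 6 \<le> 3 * card U + 6 * h"
proof -
  let ?D = "\<lambda>N A B. 0 < N \<and> handle_grid.trace h N A \<inter> handle_grid.trace h N B = {}"
  have ev: "\<forall>\<^sub>F N in sequentially. b \<longrightarrow> ?D N A B" if "compact A" "compact B" "b \<Longrightarrow> A \<inter> B = {}" for b A B
    using trace_disjoint[of A B h] that by (cases b) auto
  have "\<forall>\<^sub>F N in sequentially. \<forall>u\<in>U. \<forall>v\<in>U. u \<noteq> v \<longrightarrow> ?D N (X u) (X v)"
    using X XX by (intro eventually_ball_finite ballI fin ev) blast+
  moreover have "\<forall>\<^sub>F N in sequentially. \<forall>k\<in>H. \<forall>l\<in>H. k \<noteq> l \<longrightarrow> ?D N (Y k) (Y l)"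
    using Y YY by (intro eventually_ball_finite ballI fin ev) blast+
  moreover have "\<forall>\<^sub>F N in sequentially. \<forall>u\<in>U. \<forall>k\<in>H. u \<notin> k \<longrightarrow> ?D N (X u) (Y k)"
    using X Y XY by (intro eventually_ball_finite ballI fin ev) blast+
  ultimately have "\<forall>\<^sub>F N in sequentially. 0 < N \<and> (\<forall>u\<in>U. \<forall>v\<in>U. u \<noteq> v \<longrightarrow> ?D N (X u) (X v)) \<and>
    (\<forall>k\<in>H. \<forall>l\<in>H. k \<noteq> l \<longrightarrow> ?D N (Y k) (Y l)) \<and> (\<forall>u\<in>U. \<forall>k\<in>H. u \<notin> k \<longrightarrow> ?D N (X u) (Y k))"
    using eventually_gt_at_top[of "0 :: nat"] by eventually_elim blast
  then obtain N where n0: "0 < N" and "\<forall>u\<in>U. \<forall>v\<in>U. u \<noteq> v \<longrightarrow> ?D N (X u) (X v)"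
    "\<forall>k\<in>H. \<forall>l\<in>H. k \<noteq> l \<longrightarrow> ?D N (Y k) (Y l)" "\<forall>u\<in>U. \<forall>k\<in>H. u \<notin> k \<longrightarrow> ?D N (X u) (Y k)"
    by (auto dest!: eventually_happens'[OF sequentially_bot])
  note disj = this(2-4)
  interpret handle_grid h N by unfold_locales (rule n0)
  have d: "u \<in> U \<Longrightarrow> v \<in> U \<Longrightarrow> u \<noteq> v \<Longrightarrow> trace (X u) \<inter> trace (X v) = {}"
    "k \<in> H \<Longrightarrow> l \<in> H \<Longrightarrow> k \<noteq> l \<Longrightarrow> trace (Y k) \<inter> trace (Y l) = {}"
    "u \<in> U \<Longrightarrow> k \<in> H \<Longrightarrow> u \<notin> k \<Longrightarrow> trace (X u) \<inter> trace (Y k) = {}" for u v k l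
    using disj by simp_all
  have "\<exists>\<beta>. \<beta> ` nodes \<subseteq> U \<and>
    (\<forall>x\<in>nodes. \<forall>y\<in>nodes. \<beta> x = \<beta> y \<longrightarrow> (x, y) \<in> linked src tgt {e \<in> edges. \<beta> (src e) = \<beta> (tgt e)}) \<and>
    (\<forall>k\<in>H. \<exists>e\<in>edges. \<beta> (src e) \<noteq> \<beta> (tgt e) \<and> {\<beta> (src e), \<beta> (tgt e)} = k)"
  proof (rule subdivision_labelling[where D = "\<lambda>u. trace (X u)" and M = "\<lambda>k. trace (Y k)"])
    show "trace (X u) \<noteq> {} \<and> trace (X u) \<subseteq> nodes \<and> linked_within src tgt edges (trace (X u))" if "u \<in> U" for u
      using X[OF that] trace_Int_nonempty[of "X u" "X u"] trace_subset_nodes trace_linked by auto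
    show "trace (Y k) \<subseteq> nodes \<and> linked_within src tgt edges (trace (Y k))" if "k \<in> H" for k
      using Y[OF that] trace_subset_nodes trace_linked by auto
    show "trace (X u) \<inter> trace (Y k) \<noteq> {} \<longleftrightarrow> u \<in> k" if "u \<in> U" "k \<in> H" for u k
      using d(3)[OF that] XY[OF that] X[OF that(1)] trace_Int_nonempty[of "X u" "Y k"] by blast
    show "\<exists>u v. u \<noteq> v \<and> k = {u, v} \<and> u \<in> U \<and> v \<in> U" if "k \<in> H" for k using H[OF that] .
  qed (auto simp: finite_nodes edge_ends U d intro: nodes_linked)
  then obtain \<beta> where \<beta>: "\<beta> ` nodes \<subseteq> U"
    and conn: "\<forall>x\<in>nodes. \<forall>y\<in>nodes. \<beta> x = \<beta> y \<longrightarrow> (x, y) \<in> linked src tgt {e \<in> edges. \<beta> (src e) = \<beta> (tgt e)}"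
    and real: "\<forall>k\<in>H. \<exists>e\<in>edges. \<beta> (src e) \<noteq> \<beta> (tgt e) \<and> {\<beta> (src e), \<beta> (tgt e)} = k"
    by (elim exE conjE)
  have "card H + 3 * (card nodes + card faces) \<le> 3 * (card U + card edges)"
  proof (rule minor_edge_bound[where a = src and b = tgt and f\<^sub>1 = fst and f\<^sub>2 = "\<lambda>e. fst (glue e)" and \<beta> = \<beta>])
    show "fst e \<in> faces \<and> fst (glue e) \<in> faces" if "e \<in> edges" for e
      using glue_involution[OF subsetD[OF edges_subset that]] subsetD[OF edges_subset that]
      unfolding darts_def mem_Times_iff by blast
    show "(x, y) \<in> linked src tgt {e \<in> edges. \<beta> (src e) = \<beta> (tgt e)}"
      if "x \<in> nodes" "y \<in> nodes" "\<beta> x = \<beta> y" for x y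
      using conn that by simp
    show "\<exists>e\<in>edges. \<beta> (src e) \<noteq> \<beta> (tgt e) \<and> {\<beta> (src e), \<beta> (tgt e)} = k" if "k \<in> H" for k
      using real that by simp
    show "C = faces" if "C \<subseteq> faces" "C \<noteq> {}" "\<And>e. e \<in> edges \<Longrightarrow> fst e \<in> C \<longleftrightarrow> fst (glue e) \<in> C" for C
      using edge_dual_connected that by simp
  qed (fact finite_nodes finite_edges finite_faces fin boundary_cut_even \<beta> two)+
  \<comment> \<open>Each of the \<open>h\<close> holes has two ends, and each end costs one
    vertex.\<close>
  moreover have "card faces + 2 \<le> card nodes + 2 * h"
    using card_nodes_ge card_hole_ends[OF N_pos, of h] by linarith
  ultimately show ?thesis using card_edges unfolding distrib_left by linarith
qed

lemma embeds_in_edge_bound: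
  fixes G :: "('a, 'b) pre_digraph"
  assumes "graph G" and emb: "embeds_in G (sphere_with_handles h)"
    and two: "2 \<le> card (undirected_edges G)"
  shows "card (undirected_edges G) + 6 \<le> 3 * card (verts G) + 6 * h"
proof -
  interpret graph G by fact
  let ?H = "undirected_edges G" and ?S = "sphere_with_handles h"
  have H: "\<exists>u v. u \<noteq> v \<and> k = {u, v} \<and> u \<in> verts G \<and> v \<in> verts G" if k: "k \<in> ?H" for k
  proof -
    obtain u v where uv: "k = {u, v}" "u \<rightarrow>\<^bsub>G\<^esub> v" using k unfolding undirected_edges_def by blast
    then show ?thesis using adj_not_same[of u] adj_in_verts[OF uv(2)] by metis
  qed
  have finH: "finite ?H" using two by (metis card.infinite not_numeral_le_zero)
  have "?H \<noteq> {}" using two by auto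
  then have U: "verts G \<noteq> {}" using H by blast
  obtain p g where inj: "inj_on p (verts G)" and pS: "p ` verts G \<subseteq> ?S"
    and arc: "\<And>e. e \<in> ?H \<Longrightarrow> Path_Connected.arc (g e) \<and> path_image (g e) \<subseteq> ?S \<and>
           {pathstart (g e), pathfinish (g e)} = p ` e \<and> path_image (g e) \<inter> p ` verts G = p ` e"
    and meet: "\<And>e f. e \<in> ?H \<Longrightarrow> f \<in> ?H \<Longrightarrow> e \<noteq> f \<Longrightarrow> path_image (g e) \<inter> path_image (g f) = p ` (e \<inter> f)"
    using emb unfolding embeds_in_def by metis
  have cont: "continuous_on {0..1} (g e)" and ginj: "inj_on (g e) {0..1}" and im: "path_image (g e) = g e ` {0..1}"
    and gS: "g e ` {0..1} \<subseteq> ?S" and ends: "{g e 0, g e 1} = p ` e" if "e \<in> ?H" for e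
    using arc[OF that] unfolding Path_Connected.arc_def path_def path_image_def pathstart_def pathfinish_def by auto
  \<comment> \<open>The closed thirds share the parameters 1/3 and 2/3 with the middle part, so a
    star meets the middle of each edge at its vertex.\<close>
  define third where "third e u = (if g e 0 = p u then {0..1/3} else {2/3..1 :: real})" for e u
  \<comment> \<open>Inserting \<open>p u\<close> keeps the star of an isolated vertex
    nonempty.\<close>
  define X where "X u = insert (p u) (\<Union>e\<in>{e \<in> ?H. u \<in> e}. g e ` third e u)" for u
  define Y where "Y e = g e ` {1/3..2/3}" for e
  have third_sub: "third e u \<subseteq> {0..1}" for e u unfolding third_def by auto
  have pu: "p u \<in> g e ` third e u" if "e \<in> ?H" "u \<in> e" for e u
  proof -
    have "p u = g e 0 \<or> p u = g e 1" using ends[OF that(1)] that(2) by blast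
    then show ?thesis unfolding third_def
      by (cases "g e 0 = p u") (auto intro: image_eqI[of _ _ 0] image_eqI[of _ _ 1])
  qed
  have end_third: "w = u" if e: "e \<in> ?H" "u \<in> e" "w \<in> e" "p w \<in> g e ` third e u" for e u w
  proof (rule ccontr)
    assume "w \<noteq> u"
    obtain t where t: "t \<in> third e u" "p w = g e t" using e(4) by blast
    have uw: "u \<in> verts G" "w \<in> verts G" using H[OF e(1)] e(2,3) by auto
    then have "p w \<noteq> p u" using inj \<open>w \<noteq> u\<close> by (meson inj_onD)
    moreover have "p u = g e 0 \<or> p u = g e 1" "p w = g e 0 \<or> p w = g e 1" using ends[OF e(1)] e(2,3) by blast+
    ultimately consider "p u = g e 0" "p w = g e 1" | "p u = g e 1" "p w = g e 0" "g e 0 \<noteq> p u" by metis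
    then show False
    proof cases
      case 1
      then have "t = 1" using t third_sub[of e u] inj_onD[OF ginj[OF e(1)], of t 1] by auto
      then show False using t(1) 1 unfolding third_def by simp
    next
      case 2
      then have "t = 0" using t third_sub[of e u] inj_onD[OF ginj[OF e(1)], of t 0] by auto
      then show False using t(1) 2 unfolding third_def by simp
    qed
  qed
  have Y_end: "p w \<notin> Y e" if e: "e \<in> ?H" "w \<in> e" for e w
  proof
    assume "p w \<in> Y e"
    then obtain t where t: "t \<in> {1/3..2/3}" "p w = g e t" unfolding Y_def by blast
    have "p w = g e 0 \<or> p w = g e 1" using ends[OF e(1)] e(2) by blast
    then show False using t inj_onD[OF ginj[OF e(1)], of t 0] inj_onD[OF ginj[OF e(1)], of t 1] by auto
  qed
  have Y_sub: "Y e \<subseteq> path_image (g e)" if "e \<in> ?H" for e unfolding im[OF that] Y_def by auto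
  have T_sub: "g e ` third e u \<subseteq> path_image (g e)" if "e \<in> ?H" for e u unfolding im[OF that] using third_sub by blast
  have vertex_on: "u \<in> e" if "e \<in> ?H" "u \<in> verts G" "p u \<in> path_image (g e)" for e u
  proof -
    have "p u \<in> p ` e" using arc[OF that(1)] that(2,3) by blast
    moreover have "e \<subseteq> verts G" using H[OF that(1)] by auto
    ultimately show ?thesis using inj that(2) by (meson inj_on_image_mem_iff)
  qed
  show ?thesis
  proof (rule subdivision_in_surface_edge_bound[where X = X and Y = Y])
    show "compact (X u) \<and> Topological_Spaces.connected (X u) \<and> X u \<noteq> {} \<and> X u \<subseteq> ?S" if u: "u \<in> verts G" for u
    proof (intro conjI)
      have c: "compact (g e ` third e u)" "Topological_Spaces.connected (g e ` third e u)" if "e \<in> ?H" for e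
        using continuous_on_subset[OF cont[OF that] third_sub[of e u]] unfolding third_def
        by (auto intro!: compact_continuous_image connected_continuous_image)
      show "compact (X u)" unfolding X_def
        using c(1) finH by (intro compact_insert compact_UN) auto
      have "X u = (\<Union>A\<in>insert {p u} ((\<lambda>e. g e ` third e u) ` {e \<in> ?H. u \<in> e}). A)"
        unfolding X_def by auto
      also have "Topological_Spaces.connected \<dots>"
        using c(2) pu by (intro connected_Union) auto
      finally show "Topological_Spaces.connected (X u)" .
      show "X u \<noteq> {}" unfolding X_def by blast
      show "X u \<subseteq> ?S" using pS u T_sub arc unfolding X_def by blast
    qed
    show "compact (Y k) \<and> Topological_Spaces.connected (Y k) \<and> Y k \<subseteq> ?S" if "k \<in> ?H" for k
    proof (intro conjI)
      have "continuous_on {1/3..2/3} (g k)" by (rule continuous_on_subset[OF cont[OF that]]) auto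
      then show "compact (Y k)" "Topological_Spaces.connected (Y k)" unfolding Y_def
        by (auto intro!: compact_continuous_image connected_continuous_image)
      show "Y k \<subseteq> ?S" using Y_sub[OF that] arc[OF that] by blast
    qed
    show "Y k \<inter> Y l = {}" if "k \<in> ?H" "l \<in> ?H" "k \<noteq> l" for k l
    proof -
      have "Y k \<inter> Y l \<subseteq> p ` (k \<inter> l)" using meet[OF that] Y_sub[OF that(1)] Y_sub[OF that(2)] by blast
      then show ?thesis using Y_end[OF that(1)] by blast
    qed
    show "X u \<inter> Y k \<noteq> {} \<longleftrightarrow> u \<in> k" if u: "u \<in> verts G" and k: "k \<in> ?H" for u k
    proof
      assume "u \<in> k"
      have "g k (1/3) \<in> Y k" "g k (2/3) \<in> Y k" unfolding Y_def by auto
      moreover have "g k (1/3) \<in> g k ` third k u \<or> g k (2/3) \<in> g k ` third k u" unfolding third_def by auto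
      ultimately show "X u \<inter> Y k \<noteq> {}" using \<open>u \<in> k\<close> k unfolding X_def by blast
    next
      assume "X u \<inter> Y k \<noteq> {}"
      then obtain y where y: "y \<in> X u" "y \<in> Y k" by blast
      show "u \<in> k"
      proof (cases "y = p u")
        case True
        then show ?thesis using y Y_sub[OF k] vertex_on[OF k u] by blast
      next
        case False
        then obtain e where e: "e \<in> ?H" "u \<in> e" "y \<in> g e ` third e u" using y(1) unfolding X_def by blast
        show ?thesis
        proof (cases "e = k")
          case False
          then have "y \<in> p ` (e \<inter> k)" using meet[OF e(1) k] e(3) y(2) T_sub[OF e(1)] Y_sub[OF k] by blast
          then show ?thesis using Y_end[OF k] y(2) by blast
        qed (use e in blast)
      qed
    qed
    show "X u \<inter> X v = {}" if uv: "u \<in> verts G" "v \<in> verts G" "u \<noteq> v" for u v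
    proof (rule ccontr)
      have no: "p a \<notin> g e ` third e b" if "a \<in> verts G" "e \<in> ?H" "b \<in> e" "a \<noteq> b" for a b e
        using that vertex_on[of e a] end_third[of e b a] T_sub[of e b] by blast
      assume "X u \<inter> X v \<noteq> {}"
      then obtain y where y: "y \<in> X u" "y \<in> X v" by blast
      have ne: "p a \<noteq> p b" if "a \<in> verts G" "b \<in> verts G" "a \<noteq> b" for a b
        using inj that by (meson inj_onD)
      have notX: "p a \<notin> X b" if "a \<in> verts G" "b \<in> verts G" "a \<noteq> b" for a b
        using no[OF that(1) _ _ that(3)] ne[OF that] unfolding X_def by blast
      have "p u \<noteq> p v" using ne uv by blast
      have "y \<noteq> p u" "y \<noteq> p v" using notX[of u v] notX[of v u] uv y by auto
      then obtain e f where e: "e \<in> ?H" "u \<in> e" "y \<in> g e ` third e u" and f: "f \<in> ?H" "v \<in> f" "y \<in> g f ` third f v"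
        using y unfolding X_def by blast
      show False
      proof (cases "e = f")
        case True
        have "p u = g e 0 \<or> p u = g e 1" "p v = g e 0 \<or> p v = g e 1" using ends[OF e(1)] e(2) f(2) True by blast+
        then have "third e u \<inter> third e v = {}" using \<open>p u \<noteq> p v\<close> unfolding third_def by auto
        moreover have "third e u \<subseteq> {0..1}" "third e v \<subseteq> {0..1}" using third_sub by blast+
        ultimately have "g e ` third e u \<inter> g e ` third e v = {}"
          using inj_on_image_Int[OF ginj[OF e(1)], of "third e u" "third e v"] by simp
        then show False using e(3) f(3) True by blast
      next
        case False
        then have "y \<in> p ` (e \<inter> f)" using meet[OF e(1) f(1)] e(3) f(3) T_sub[OF e(1)] T_sub[OF f(1)] by blast
        then obtain w where w: "w \<in> e" "w \<in> f" "y = p w" by blast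
        then show False using end_third[OF e(1,2) w(1)] end_third[OF f(1,2) w(2)] e(3) f(3) uv(3) by blast
      qed
    qed
  qed (use finH H U two in auto)
qed


section \<open>Degree counting and the genus bound\<close>

lemma card_arcs_le:
  assumes "graph G"
  shows "card (arcs G) \<le> 2 * card (undirected_edges G)"
proof -
  interpret graph G by fact
  have eq: "undirected_edges G = (\<lambda>(u, v). {u, v}) ` arcs_ends G"
    unfolding undirected_edges_def by auto
  have fin: "finite (arcs_ends G)" unfolding arcs_ends_conv by auto
  then have finU: "finite (undirected_edges G)" unfolding eq by simp
  have "inj_on (\<lambda>e. (tail G e, head G e)) (arcs G)"
    using no_multi_arcs by (auto simp: inj_on_def arc_to_ends_def)
  then have "card (arcs G) = card (arcs_ends G)" unfolding arcs_ends_conv by (simp add: card_image)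
  also have "\<dots> \<le> card (\<Union>k\<in>undirected_edges G. {(u, v) \<in> arcs_ends G. {u, v} = k})"
    by (intro card_mono finite_subset[OF _ fin]) (auto simp: eq)
  also have "\<dots> \<le> (\<Sum>k\<in>undirected_edges G. card {(u, v) \<in> arcs_ends G. {u, v} = k})"
    by (rule card_UN_le[OF finU])
  also have "\<dots> \<le> (\<Sum>k\<in>undirected_edges G. 2)"
  proof (rule sum_mono)
    fix k assume "k \<in> undirected_edges G"
    then obtain a b where k: "k = {a, b}" unfolding undirected_edges_def by blast
    have "{(u, v) \<in> arcs_ends G. {u, v} = k} \<subseteq> {(a, b), (b, a)}"
      unfolding k by (auto simp: doubleton_eq_iff)
    then have "card {(u, v) \<in> arcs_ends G. {u, v} = k} \<le> card {(a, b), (b, a)}"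
      by (intro card_mono) auto
    also have "\<dots> \<le> 2" using card_length[of "[(a, b), (b, a)]"] by simp
    finally show "card {(u, v) \<in> arcs_ends G. {u, v} = k} \<le> 2" .
  qed
  finally show "card (arcs G) \<le> 2 * card (undirected_edges G)" by simp
qed

lemma regular_degree_bound:
  assumes "graph G" "verts G \<noteq> {}" "\<And>v. v \<in> verts G \<Longrightarrow> out_degree G v = d"
  shows "d + 1 \<le> card (verts G)" "card (verts G) * d = card (arcs G)"
proof -
  interpret graph G by fact
  obtain v where v: "v \<in> verts G" using assms(2) by blast
  have "inj_on (head G) (out_arcs G v)"
    using no_multi_arcs by (auto simp: inj_on_def arc_to_ends_def)
  moreover have "head G ` out_arcs G v \<subseteq> verts G - {v}" using no_loops by fastforce
  ultimately have "card (out_arcs G v) \<le> card (verts G - {v})" by (intro card_inj_on_le) auto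
  then have "d \<le> card (verts G) - 1" using assms(3)[OF v] v unfolding out_degree_def by simp
  moreover have "0 < card (verts G)" using v by (auto simp: card_gt_0_iff)
  ultimately show "d + 1 \<le> card (verts G)" by linarith
  have "card (arcs G) = card (\<Union>v\<in>verts G. out_arcs G v)"
    by (rule arg_cong[where f = card]) auto
  also have "\<dots> = (\<Sum>v\<in>verts G. card (out_arcs G v))"
    by (rule card_UN_disjoint) auto
  also have "\<dots> = card (verts G) * d" using assms(3) unfolding out_degree_def by simp
  finally show "card (verts G) * d = card (arcs G)" by simp
qed

text \<open>Euler's inequality and \<open>n * d \<le> 2 * m\<close> give
  \<open>n * (d - 6) + 12 \<le> 12 * h\<close>. For \<open>d \<ge> 6\<close> the left side grows
  with \<open>n\<close>, and at \<open>n = d + 1\<close> it equals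
  \<open>(d - 2) * (d - 3)\<close>.\<close>

lemma regular_graph_genus_bound:
  assumes G: "graph G" "verts G \<noteq> {}" "\<And>v. v \<in> verts G \<Longrightarrow> out_degree G v = d" and d: "6 \<le> d"
    and emb: "embeds_in G (sphere_with_handles h)"
  shows "(real d - 2) * (real d - 3) \<le> 12 * real h"
proof -
  let ?n = "card (verts G)" and ?m = "card (undirected_edges G)"
  have n: "d + 1 \<le> ?n" and "?n * d \<le> 2 * ?m"
    using regular_degree_bound[OF G] card_arcs_le[OF G(1)] by simp_all
  moreover have "7 * 6 \<le> ?n * d" using n d by (intro mult_le_mono) auto
  ultimately have "?m + 6 \<le> 3 * ?n + 6 * h"
    using embeds_in_edge_bound[OF G(1) emb] by linarith
  then have "?n * d + 12 \<le> 6 * ?n + 12 * h" using \<open>?n * d \<le> 2 * ?m\<close> by linarith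
  then have "real (?n * d + 12) \<le> real (6 * ?n + 12 * h)" by (rule of_nat_mono)
  then have "real ?n * (real d - 6) + 12 \<le> 12 * real h" by (simp add: algebra_simps)
  moreover have "(real d + 1) * (real d - 6) \<le> real ?n * (real d - 6)"
    using n d by (intro mult_right_mono) auto
  ultimately show ?thesis by (simp add: algebra_simps)
qed

theorem theorem7p1:
  fixes G :: "('a, 'b) pre_digraph" and n d \<gamma> :: nat
  assumes "ramanujan_graph G d"
    and "card (verts G) = n"
    and "9 \<le> d"
    and "d \<noteq> n - 1"
    and "is_orientable_genus G \<gamma>"
  shows "int \<gamma> \<ge> \<lceil>((2 * real d - 4 * sqrt (real d - 1) - 5)\<^sup>2 - 1) / 48\<rceil>"
proof -
  have "graph G" "verts G \<noteq> {}" "\<And>v. v \<in> verts G \<Longrightarrow> out_degree G v = d"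
    using assms(1) unfolding ramanujan_graph_def Digraph_Component.connected_def strongly_connected_def
    by auto
  then have genus: "(real d - 2) * (real d - 3) \<le> 12 * real \<gamma>"
    using assms(3,5) unfolding is_orientable_genus_def by (intro regular_graph_genus_bound) auto
  define x where "x = real d - 2 * sqrt (real d - 1)"
  have d9: "9 \<le> real d" using assms(3) by simp
  \<comment> \<open>The difference of the two sides is \<open>(d - 9) * (d - 1) + 4\<close>. The
    resulting \<open>x \<ge> 3\<close> makes both factors of \<open>(x - 2) * (x - 3)\<close>
    nonnegative, so that the product is monotone.\<close>
  have "4 * (real d - 1) \<le> (real d - 3)\<^sup>2"
  proof -
    have "0 \<le> (real d - 9) * (real d - 1)" using d9 by simp
    then show ?thesis by (simp add: power2_eq_square algebra_simps)
  qed
  then have "sqrt (4 * (real d - 1)) \<le> real d - 3" using d9 by (intro real_le_lsqrt) auto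
  then have "3 \<le> x" unfolding x_def real_sqrt_mult by simp
  moreover have "x \<le> real d" unfolding x_def using d9 by simp
  ultimately have "(x - 2) * (x - 3) \<le> (real d - 2) * (real d - 3)" by (intro mult_mono) auto
  then have "(x - 2) * (x - 3) \<le> 12 * real \<gamma>" using genus by linarith
  moreover have eq: "2 * real d - 4 * sqrt (real d - 1) - 5 = 2 * x - 5" unfolding x_def by simp
  \<comment> \<open>A difference of squares: \<open>(2 * x - 5)^2 - 1\<close> is
    \<open>(2 * x - 4) * (2 * x - 6)\<close>.\<close>
  have "((2 * x - 5)\<^sup>2 - 1) / 48 = (x - 2) * (x - 3) / 12" by (simp add: power2_eq_square field_simps)
  ultimately show ?thesis unfolding eq by (simp add: ceiling_le_iff)
qed

end
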